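(* Fix $0<\alpha<d$. For $t>-1$ let $r_t^{(n)}(x,y):=(1+t)\,\zeta_n^{-1}J(x,y)$, $x,y\in\mathbb{T}_n^d$. (a) (Purely subcritical regime) There exists $C>0$ depending only on $d$ such that for every $\varepsilon\in(0,1)$, $$\mathbb{P}\big(|\mathcal{C}_1^{(n)}(r_{-\varepsilon}^{(n)})|\le C\varepsilon^{-2}\log n\big)\to 1\quad\text{as } n\to\infty .$$ (b) (Purely supercritical regime) Fix $\varepsilon>0$. Then there exists $C>0$ depending only on $\varepsilon,\alpha,A_1,A_2$ and $d$ such that $$\mathbb{P}\big(|\mathcal{C}_1^{(n)}(r_{\varepsilon}^{(n)})|\ge C n^d\big)\to 1\quad\text{as } n\to\infty .$$
   Context: Let $d\ge 1$ be an integer. For $n\ge 3$, $\mathbb{T}_n^d=\mathbb{Z}^d/n\mathbb{Z}^d$ is the discrete torus on $n^d$ vertices; $\|x-y\|$ is the distance between $x,y\in\mathbb{T}_n^d$ in the quotient metric inherited from the $\ell^\infty$ distance on $\mathbb{Z}^d$. Its diameter is $d_n=\lfloor n/2\rfloor$. Let $0<A_1\le A_2$ and let $\rho:[0,\infty)\to[0,\infty)$ satisfy $\rho(0)=0$ and $A_1r^{-\alpha}\le\rho(r)\le A_2r^{-\alpha}$ for all $r\ge 1$; let $J(x,y)=\rho(\|x-y\|)$. For $n\ge 3$, $\zeta_n$ is the unique positive number satisfying $$\sum_{i=1}^{d_n-1}\big((2i+1)^d-(2i-1)^d\big)\exp(-\zeta_n^{-1}\rho(i))+\big(n^d-(2d_n-1)^d\big)\exp(-\zeta_n^{-1}\rho(d_n))=n^d-2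 .$$ For symmetric $\kappa:\mathbb{T}_n^d\times\mathbb{T}_n^d\to[0,\infty)$, consider the random graph with vertex set $\mathbb{T}_n^d$ obtained by placing edges independently between each pair $x\ne y$ with probability $1-\exp(-\kappa(x,y))$; $\mathcal{C}_i^{(n)}(\kappa)$ is its $i$-th largest component (by number of vertices), and $|\mathcal{C}|$ is the number of vertices of $\mathcal{C}$. *)

theory Defs
  imports "HOL-Probability.Probability"
begin

definition int_lattice :: "nat \<Rightarrow> (nat \<Rightarrow> int) set" where
  "int_lattice d = {..<d} \<rightarrow>\<^sub>E UNIV"

definition torus_rel :: "nat \<Rightarrow> nat \<Rightarrow> ((nat \<Rightarrow> int) \<times> (nat \<Rightarrow> int)) set" where
  "torus_rel d n =
     {(x, y). x \<in> int_lattice d \<and> y \<in> int_lattice d \<and> (\<forall>i<d. int n dvd x i - y i)}"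

definition torus :: "nat \<Rightarrow> nat \<Rightarrow> (nat \<Rightarrow> int) set set" where
  "torus d n = int_lattice d // torus_rel d n"

definition linf_dist :: "nat \<Rightarrow> (nat \<Rightarrow> int) \<Rightarrow> (nat \<Rightarrow> int) \<Rightarrow> nat" where
  "linf_dist d x y = Max ((\<lambda>i. nat \<bar>x i - y i\<bar>) ` {..<d})"

definition torus_dist :: "nat \<Rightarrow> (nat \<Rightarrow> int) set \<Rightarrow> (nat \<Rightarrow> int) set \<Rightarrow> nat" where
  "torus_dist d X Y = Inf {linf_dist d x y | x y. x \<in> X \<and> y \<in> Y}"

definition power_law_profile :: "real \<Rightarrow> real \<Rightarrow> real \<Rightarrow> (real \<Rightarrow> real) \<Rightarrow> bool" where
  "power_law_profile A1 A2 \<alpha> \<rho> \<longleftrightarrow>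
     (\<forall>r\<ge>0. 0 \<le> \<rho> r) \<and> \<rho> 0 = 0 \<and>
     (\<forall>r\<ge>1. A1 * r powr (- \<alpha>) \<le> \<rho> r \<and> \<rho> r \<le> A2 * r powr (- \<alpha>))"

definition torus_diam :: "nat \<Rightarrow> nat" where
  "torus_diam n = n div 2"

text \<open>For \<open>n \<ge> 3\<close> the coefficients count the vertices at each distance \<open>i \<ge> 1\<close> from a given
  vertex, so the equation says that the expected degree of the random graph with edge
  probabilities \<open>1 - exp (- \<rho> (dist x y) / z)\<close> equals \<open>1\<close>.\<close>

definition zeta_eq :: "nat \<Rightarrow> (real \<Rightarrow> real) \<Rightarrow> nat \<Rightarrow> real \<Rightarrow> bool" where
  "zeta_eq d \<rho> n z \<longleftrightarrow>
     (\<Sum>i = 1..torus_diam n - 1.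
        ((2 * real i + 1) ^ d - (2 * real i - 1) ^ d) * exp (- inverse z * \<rho> (real i)))
     + (real n ^ d - (2 * real (torus_diam n) - 1) ^ d)
         * exp (- inverse z * \<rho> (real (torus_diam n)))
     = real n ^ d - 2"

definition zeta :: "nat \<Rightarrow> (real \<Rightarrow> real) \<Rightarrow> nat \<Rightarrow> real" where
  "zeta d \<rho> n = (THE z. 0 < z \<and> zeta_eq d \<rho> n z)"

definition rate_kernel ::
  "nat \<Rightarrow> (real \<Rightarrow> real) \<Rightarrow> nat \<Rightarrow> real \<Rightarrow> (nat \<Rightarrow> int) set \<Rightarrow> (nat \<Rightarrow> int) set \<Rightarrow> real" where
  "rate_kernel d \<rho> n t X Y = (1 + t) * inverse (zeta d \<rho> n) * \<rho> (real (torus_dist d X Y))"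

text \<open>A simple graph on a fixed vertex set is encoded by its set of edges, each edge being a
  two-element set of vertices.\<close>

definition vertex_pairs :: "'v set \<Rightarrow> 'v set set" where
  "vertex_pairs V = {{x, y} | x y. x \<in> V \<and> y \<in> V \<and> x \<noteq> y}"

text \<open>The definite description is uniquely satisfied for a two-element set \<open>e\<close> whenever \<open>\<kappa>\<close> is symmetric.\<close>

definition edge_prob :: "('v \<Rightarrow> 'v \<Rightarrow> real) \<Rightarrow> 'v set \<Rightarrow> real" where
  "edge_prob \<kappa> e = (THE p. \<exists>x y. e = {x, y} \<and> p = 1 - exp (- \<kappa> x y))"

definition random_graph :: "'v set \<Rightarrow> ('v \<Rightarrow> 'v \<Rightarrow> real) \<Rightarrow> 'v set set pmf" where
  "random_graph V \<kappa> =
     map_pmf (\<lambda>\<omega>. {e \<in> vertex_pairs V. \<omega> e})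
       (Pi_pmf (vertex_pairs V) False (\<lambda>e. bernoulli_pmf (edge_prob \<kappa> e)))"

definition connected_rel :: "'v set \<Rightarrow> 'v set set \<Rightarrow> ('v \<times> 'v) set" where
  "connected_rel V E = {(x, y). x \<in> V \<and> y \<in> V \<and> (x, y) \<in> {(u, v). {u, v} \<in> E}\<^sup>*}"

definition components_of_graph :: "'v set \<Rightarrow> 'v set set \<Rightarrow> 'v set set" where
  "components_of_graph V E = V // connected_rel V E"

definition largest_component_size :: "'v set \<Rightarrow> 'v set set \<Rightarrow> nat" where
  "largest_component_size V E = Max (card ` components_of_graph V E)"

end

theory Submission
  imports Defs
begin

text \<open>
  Give each pair of vertices the weight \<open>w X Y = \<rho> (dist X Y) / \<zeta>\<close>. The equation that defines \<open>\<zeta>\<close> says that at \<open>t = 0\<close> the expected degree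
  \<open>\<Sum>Y. 1 - exp (- w X Y)\<close> of every vertex equals 1. Two facts about \<open>w\<close> carry the proof, and both come
  from \<open>\<alpha> < d\<close> through \<open>inverse \<zeta> = O(n powr (\<alpha> - d))\<close>: all weights tend to 0 uniformly
  (\<open>rate_le\<close>), and a set of at most \<open>\<delta> n ^ d\<close> vertices has total weight at most \<open>\<tau>\<close> as seen from any
  vertex, once \<open>\<delta>\<close> is small (\<open>small_set_small_rate\<close>). As \<open>1 - exp (- x)\<close> is asymptotic to
  \<open>x\<close> for small \<open>x\<close>, the first fact makes the expected degree at parameter \<open>t\<close> close to \<open>1 + t\<close>. The second
  one says that deleting a small fraction of the vertices, wherever they lie, keeps a supercritical
  degree supercritical.

  Both regimes are then settled by the same exploration, phrased as an induction that reveals one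
  vertex \<open>s\<close> of a set \<open>S\<close> of active vertices at a time: \<open>s\<close> is removed and its neighbours \<open>N\<close> become
  active. The graph on the other vertices is independent of \<open>N\<close>, and
  \<open>E (m ^ card N) = (\<Prod>y. 1 + (m - 1) p\<^sub>y) \<le> exp ((m - 1) (\<Sum>y. p\<^sub>y))\<close>, for \<open>m > 1\<close> and \<open>m < 1\<close> alike
  (\<open>bond_graph_reveal_vertex\<close>).

  In the subcritical regime \<open>m > 1\<close> yields \<open>P (card (cluster S) \<ge> k) \<le> m ^ card S * a ^ k\<close> with
  \<open>a < 1\<close>, if all expected degrees are below 1 (\<open>prob_cluster_ge\<close>). If they are at most \<open>1 - \<epsilon> / 2\<close>, then \<open>m = 1 + \<epsilon> / 4\<close> and
  \<open>a = exp (- \<epsilon>\<^sup>2 / 16)\<close> are admissible, and a union bound over the \<open>n ^ d\<close> vertices finishes the argument.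

  In the supercritical regime \<open>m < 1\<close> is used. Suppose that all clusters have fewer than \<open>M\<close> vertices,
  restart the exploration at a new vertex whenever no active one is left, and stop after \<open>k\<close> steps.
  The exploration has then never met more than \<open>k + M \<le> \<delta> n ^ d\<close> vertices, so that each step finds new
  neighbours at a rate above 1 and contributes a factor \<open>r < 1\<close> to the probability. The result
  is \<open>P (all clusters < M) \<le> r ^ k / m ^ M\<close> (\<open>prob_no_large_cluster\<close>), which is exponentially small
  in \<open>n ^ d\<close> for \<open>k\<close> about \<open>\<delta> n ^ d / 2\<close> and \<open>M\<close> a sufficiently small multiple of \<open>n ^ d\<close>. So the giant component
  appears in one exploration, without a second round of edges that joins medium-sized clusters.
\<close>

section \<open>Revealing the edges at one vertex\<close>

text \<open>This is \<^const>\<open>random_graph\<close> with arbitrary edge probabilities in place of those derived from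
  a kernel, so that the induction on the vertex set need not mention kernels.\<close>
definition bond_graph :: "'v set \<Rightarrow> ('v set \<Rightarrow> real) \<Rightarrow> 'v set set pmf" where
  "bond_graph V p =
     map_pmf (\<lambda>\<omega>. {e \<in> vertex_pairs V. \<omega> e})
       (Pi_pmf (vertex_pairs V) False (\<lambda>e. bernoulli_pmf (p e)))"

definition star :: "'v \<Rightarrow> 'v set \<Rightarrow> 'v set set" where
  "star s N = (\<lambda>y. {s, y}) ` N"

definition cluster :: "'v set set \<Rightarrow> 'v set \<Rightarrow> 'v set" where
  "cluster E S = {(u, v). {u, v} \<in> E}\<^sup>* `` S"

lemma finite_vertex_pairs: "finite V \<Longrightarrow> finite (vertex_pairs V)"
  by (rule finite_subset[of _ "Pow V"]) (auto simp: vertex_pairs_def)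

lemma inj_star: "inj_on (\<lambda>y. {s, y}) W"
  by (auto simp: inj_on_def doubleton_eq_iff)

lemma vertex_pairs_insert:
  assumes "s \<notin> W" shows "vertex_pairs (insert s W) = star s W \<union> vertex_pairs W"
  using assms unfolding vertex_pairs_def star_def by (auto simp: doubleton_eq_iff)

lemma star_disjoint_vertex_pairs: "s \<notin> W \<Longrightarrow> star s N \<inter> vertex_pairs W = {}"
  unfolding vertex_pairs_def star_def by (auto simp: doubleton_eq_iff)

text \<open>The edges at \<open>s\<close> and the edges that avoid \<open>s\<close> are disjoint families of independent variables,
  so the graph can be sampled by drawing the neighbourhood of \<open>s\<close> first.\<close>
lemma bond_graph_insert:
  assumes "finite W" "s \<notin> W"
  shows "bond_graph (insert s W) p =
    bind_pmf (Pi_pmf (star s W) False (\<lambda>e. bernoulli_pmf (p e)))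
      (\<lambda>\<omega>. map_pmf (\<lambda>E. E \<union> {e \<in> star s W. \<omega> e}) (bond_graph W p))"
proof -
  have eq: "{e \<in> star s W \<union> vertex_pairs W. if e \<in> star s W then f e else g e} =
      {e \<in> vertex_pairs W. g e} \<union> {e \<in> star s W. f e}" for f g
    using star_disjoint_vertex_pairs[OF assms(2), of W] by auto
  have fin: "finite (star s W)" using assms(1) by (simp add: star_def)
  show ?thesis
    unfolding bond_graph_def vertex_pairs_insert[OF assms(2)]
      Pi_pmf_union[OF fin finite_vertex_pairs[OF assms(1)] star_disjoint_vertex_pairs[OF assms(2)]]
    by (simp only: map_pmf_comp pair_pmf_def map_bind_pmf bind_map_pmf map_return_pmf case_prod_conv eq)
       (simp only: map_pmf_def bind_assoc_pmf bind_return_pmf)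
qed

text \<open>One step of the exploration. Conditionally on the neighbourhood \<open>N\<close> of \<open>s\<close>, the remaining graph is an
  unconditioned random graph on \<open>W\<close>, and independence of the edges at \<open>s\<close> turns the average of
  \<open>m ^ card (N \<inter> T)\<close> into \<open>\<Prod>y\<in>T. 1 + (m - 1) p {s, y}\<close>. The set \<open>T\<close> restricts attention to neighbours
  that are not yet active: this matters for \<open>m < 1\<close>, where counting a neighbour twice would be an
  illegitimate gain.\<close>
lemma bond_graph_reveal_vertex:
  assumes fin: "finite W" and s: "s \<notin> W" and T: "T \<subseteq> W" and m: "0 < m" and c: "0 \<le> c"
    and p: "\<And>y. y \<in> W \<Longrightarrow> 0 \<le> p {s, y} \<and> p {s, y} \<le> 1"
    and bnd: "\<And>N. N \<subseteq> W \<Longrightarrow>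
      measure_pmf.prob (bond_graph W p) {E. E \<union> star s N \<in> A} \<le> c * m ^ card (N \<inter> T)"
  shows "measure_pmf.prob (bond_graph (insert s W) p) A
    \<le> c * exp ((m - 1) * (\<Sum>y\<in>T. p {s, y}))"
proof -
  define Q where "Q = Pi_pmf (star s W) False (\<lambda>e. bernoulli_pmf (p e))"
  define f where "f e b = (if b \<and> e \<in> star s T then m else 1)" for e and b :: bool
  have finS: "finite (star s W)" "finite T" using fin T finite_subset by (auto simp: star_def)
  have prod_f: "(\<Prod>e\<in>star s W. f e (\<omega> e)) = m ^ card ({y \<in> W. \<omega> {s, y}} \<inter> T)" for \<omega>
  proof -
    have "(\<Prod>e\<in>star s W. f e (\<omega> e)) = (\<Prod>y\<in>W. if y \<in> {y \<in> W. \<omega> {s, y}} \<inter> T then m else 1)"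
      unfolding star_def f_def
      by (subst prod.reindex[OF inj_star]) (intro prod.cong, auto simp: doubleton_eq_iff)
    also have "\<dots> = (\<Prod>y\<in>{y \<in> W. \<omega> {s, y}} \<inter> T. m)"
      by (rule prod.mono_neutral_cong_right) (use fin in auto)
    finally show ?thesis by simp
  qed
  have pw: "measure_pmf.prob (bond_graph W p) {E. E \<union> {e \<in> star s W. \<omega> e} \<in> A}
      \<le> c * (\<Prod>e\<in>star s W. f e (\<omega> e))" for \<omega>
  proof -
    have "{e \<in> star s W. \<omega> e} = star s {y \<in> W. \<omega> {s, y}}" by (auto simp: star_def)
    thus ?thesis using bnd[of "{y \<in> W. \<omega> {s, y}}"] by (auto simp: prod_f)
  qed
  have "ennreal (measure_pmf.prob (bond_graph (insert s W) p) A)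
      = (\<integral>\<^sup>+\<omega>. ennreal (measure_pmf.prob (bond_graph W p) {E. E \<union> {e \<in> star s W. \<omega> e} \<in> A}) \<partial>Q)"
    unfolding measure_pmf.emeasure_eq_measure[symmetric] bond_graph_insert[OF fin s] Q_def
    by (auto simp: vimage_def intro!: nn_integral_cong)
  also have "\<dots> \<le> (\<integral>\<^sup>+\<omega>. ennreal (c * (\<Prod>e\<in>star s W. f e (\<omega> e))) \<partial>Q)"
    by (intro nn_integral_mono ennreal_leI pw)
  also have "\<dots> = ennreal (measure_pmf.expectation Q (\<lambda>\<omega>. c * (\<Prod>e\<in>star s W. f e (\<omega> e))))"
  proof (rule nn_integral_eq_integral)
    have "finite (set_pmf Q)"
      unfolding Q_def using finS
      by (intro finite_subset[OF set_Pi_pmf_subset'] finite_PiE_dflt) auto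
    thus "integrable (measure_pmf Q) (\<lambda>\<omega>. c * (\<Prod>e\<in>star s W. f e (\<omega> e)))"
      by (rule integrable_measure_pmf_finite)
    show "AE \<omega> in measure_pmf Q. 0 \<le> c * (\<Prod>e\<in>star s W. f e (\<omega> e))"
      using c m by (auto simp: f_def intro!: AE_I2 mult_nonneg_nonneg prod_nonneg)
  qed
  also have "measure_pmf.expectation Q (\<lambda>\<omega>. c * (\<Prod>e\<in>star s W. f e (\<omega> e)))
      = c * (\<Prod>e\<in>star s W. measure_pmf.expectation (bernoulli_pmf (p e)) (f e))"
    unfolding Q_def using m finS
    by (subst integral_mult_right_zero, subst expectation_prod_Pi_pmf)
       (auto simp: f_def intro!: integrable_measure_pmf_finite)
  finally have main: "measure_pmf.prob (bond_graph (insert s W) p) A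
      \<le> c * (\<Prod>e\<in>star s W. measure_pmf.expectation (bernoulli_pmf (p e)) (f e))"
    using c m by (subst (asm) ennreal_le_iff)
      (auto simp: f_def intro!: mult_nonneg_nonneg prod_nonneg Bochner_Integration.integral_nonneg)
  have "(\<Prod>e\<in>star s W. measure_pmf.expectation (bernoulli_pmf (p e)) (f e))
      = (\<Prod>y\<in>W. if y \<in> T then 1 + (m - 1) * p {s, y} else 1)"
    unfolding star_def by (subst prod.reindex[OF inj_star])
      (use p in \<open>auto simp: f_def star_def doubleton_eq_iff algebra_simps intro!: prod.cong\<close>)
  also have "\<dots> = (\<Prod>y\<in>T. 1 + (m - 1) * p {s, y})"
    by (rule prod.mono_neutral_cong_right) (use fin T in auto)
  also have "\<dots> \<le> (\<Prod>y\<in>T. exp ((m - 1) * p {s, y}))"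
  proof (intro prod_mono conjI)
    fix y assume "y \<in> T"
    hence "0 \<le> p {s, y}" "p {s, y} \<le> 1" using p T by auto
    hence "0 \<le> (1 - p {s, y}) + m * p {s, y}" using m by simp
    thus "0 \<le> 1 + (m - 1) * p {s, y}" by (simp add: algebra_simps)
  qed (use exp_ge_add_one_self in auto)
  also have "\<dots> = exp ((m - 1) * (\<Sum>y\<in>T. p {s, y}))"
    using finS by (simp add: exp_sum sum_distrib_left)
  finally show ?thesis
    by (intro order_trans[OF main] mult_left_mono c)
qed

section \<open>Clusters\<close>

lemma cluster_mono: "E \<subseteq> E' \<Longrightarrow> S \<subseteq> S' \<Longrightarrow> cluster E S \<subseteq> cluster E' S'"
proof -
  assume "E \<subseteq> E'" "S \<subseteq> S'"
  hence "{(u, v). {u, v} \<in> E}\<^sup>* \<subseteq> {(u, v). {u, v} \<in> E'}\<^sup>*" by (intro rtrancl_mono) auto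
  thus ?thesis using \<open>S \<subseteq> S'\<close> unfolding cluster_def by blast
qed

lemma subset_cluster: "S \<subseteq> cluster E S"
  unfolding cluster_def by auto

lemma cluster_step: "u \<in> cluster E S \<Longrightarrow> {u, v} \<in> E \<Longrightarrow> v \<in> cluster E S"
  unfolding cluster_def by (auto intro: rtrancl_into_rtrancl)

lemma cluster_least:
  assumes "S \<subseteq> X" "\<And>u v. u \<in> X \<Longrightarrow> {u, v} \<in> E \<Longrightarrow> v \<in> X"
  shows "cluster E S \<subseteq> X"
proof -
  have "{(u, v). {u, v} \<in> E}\<^sup>* `` X = X"
    by (rule Image_closed_trancl) (use assms(2) in auto)
  thus ?thesis using assms(1) unfolding cluster_def by blast
qed

lemma cluster_subset: "E \<subseteq> vertex_pairs V \<Longrightarrow> S \<subseteq> V \<Longrightarrow> cluster E S \<subseteq> V"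
  by (rule cluster_least) (force simp: vertex_pairs_def doubleton_eq_iff)+

text \<open>On the side of the graph, the exploration step replaces the active vertex \<open>s\<close> by its neighbours and costs
  exactly one vertex of the cluster.\<close>
lemma cluster_reveal_vertex:
  assumes E: "E \<subseteq> vertex_pairs W" and s: "s \<notin> W"
  shows "cluster (E \<union> star s N) (insert s S) = insert s (cluster E (S \<union> N))" (is "?L = ?R")
proof
  show "?L \<subseteq> ?R"
  proof (rule cluster_least)
    show "insert s S \<subseteq> ?R" using subset_cluster[of "S \<union> N" E] by auto
    fix u v assume u: "u \<in> ?R" and uv: "{u, v} \<in> E \<union> star s N"
    show "v \<in> ?R"
    proof (cases "{u, v} \<in> star s N")
      case True
      then obtain y where "y \<in> N" "{u, v} = {s, y}" by (auto simp: star_def)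
      thus ?thesis using subset_cluster[of "S \<union> N" E] by (auto simp: doubleton_eq_iff)
    next
      case False
      hence "{u, v} \<in> E" using uv by auto
      moreover from this have "u \<noteq> s" using E s by (auto simp: vertex_pairs_def doubleton_eq_iff)
      ultimately show ?thesis using u cluster_step[of u E _ v] by auto
    qed
  qed
  have "cluster E (S \<union> N) \<subseteq> ?L"
  proof (rule cluster_least)
    have "y \<in> ?L" if "y \<in> N" for y
      by (rule cluster_step[of s]) (use that subset_cluster[of "insert s S" "E \<union> star s N"] in \<open>auto simp: star_def\<close>)
    thus "S \<union> N \<subseteq> ?L" using subset_cluster[of "insert s S" "E \<union> star s N"] by auto
  qed (auto intro: cluster_step)
  thus "?R \<subseteq> ?L" using subset_cluster[of "insert s S" "E \<union> star s N"] by auto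
qed

lemma set_bond_graph: "E \<in> set_pmf (bond_graph V p) \<Longrightarrow> E \<subseteq> vertex_pairs V"
  by (auto simp: bond_graph_def)

text \<open>Samples are only almost surely subsets of \<^term>\<open>vertex_pairs V\<close>; hence monotonicity
  is needed in the form that may assume this.\<close>
lemma prob_bond_graph_mono:
  assumes "\<And>E. E \<subseteq> vertex_pairs V \<Longrightarrow> P E \<Longrightarrow> Q E"
  shows "measure_pmf.prob (bond_graph V p) {E. P E} \<le> measure_pmf.prob (bond_graph V p) {E. Q E}"
proof -
  have "AE E in measure_pmf (bond_graph V p). E \<in> {E. P E} \<longrightarrow> E \<in> {E. Q E}"
    using assms set_bond_graph by (force simp: AE_measure_pmf_iff)
  thus ?thesis by (intro measure_pmf.finite_measure_mono_AE) auto
qed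

section \<open>Tail bounds from exploration\<close>

text \<open>Induction on the vertex set. Revealing \<open>s \<in> S\<close> lowers \<open>k\<close> by one and changes the number of active vertices
  from \<open>card S\<close> to at most \<open>card S - 1 + card N\<close>, so the bound is reproduced as soon as
  \<open>E (m ^ card N) \<le> m * a\<close>. Deleting vertices only lowers degrees, which keeps the
  hypothesis on degrees alive.\<close>
lemma prob_cluster_ge:
  assumes "finite V" "S \<subseteq> V"
    and p: "\<And>x y. x \<in> V \<Longrightarrow> y \<in> V \<Longrightarrow> x \<noteq> y \<Longrightarrow> 0 \<le> p {x, y} \<and> p {x, y} \<le> 1"
    and deg: "\<And>x. x \<in> V \<Longrightarrow> (\<Sum>y\<in>V - {x}. p {x, y}) \<le> l"
    and m: "1 \<le> m" and a: "0 \<le> a" "exp ((m - 1) * l) \<le> m * a"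
  shows "measure_pmf.prob (bond_graph V p) {E. k \<le> card (cluster E S)} \<le> m ^ card S * a ^ k"
  using assms(1,2) p deg
proof (induction "card V" arbitrary: V S k)
  case 0
  hence "S = {}" by auto
  thus ?case using a by (cases k) (auto simp: cluster_def intro!: mult_nonneg_nonneg)
next
  case (Suc j)
  note fin = Suc.prems(1) and S = Suc.prems(2) and p = Suc.prems(3) and deg = Suc.prems(4)
  show ?case
  proof (cases "S = {} \<or> k = 0")
    case True
    thus ?thesis
    proof (cases "k = 0")
      case True
      have "1 \<le> m ^ card S" using m by simp
      thus ?thesis using True by (auto intro: order_trans[OF measure_pmf.prob_le_1])
    qed (use True a in \<open>auto simp: cluster_def intro!: mult_nonneg_nonneg\<close>)
  next
    case False
    then obtain s k' where s: "s \<in> S" and k: "k = Suc k'" using not0_implies_Suc by blast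
    define W where "W = V - {s}"
    have V: "V = insert s W" and sW: "s \<notin> W" and finW: "finite W"
      using s S fin by (auto simp: W_def)
    have cardW: "card W = j" using Suc.hyps(2) V sW finW by simp
    have finS: "finite S" using fin S finite_subset by blast
    hence cS: "card S = Suc (card (S - {s}))" using s by (metis card.remove)
    have "measure_pmf.prob (bond_graph (insert s W) p) {E. k \<le> card (cluster E S)}
        \<le> (m ^ card (S - {s}) * a ^ k') * exp ((m - 1) * (\<Sum>y\<in>W. p {s, y}))"
    proof (rule bond_graph_reveal_vertex[OF finW sW order_refl])
      fix N assume N: "N \<subseteq> W"
      have "measure_pmf.prob (bond_graph W p) {E. E \<union> star s N \<in> {E. k \<le> card (cluster E S)}}
          \<le> measure_pmf.prob (bond_graph W p) {E. k' \<le> card (cluster E ((S - {s}) \<union> N))}"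
        unfolding mem_Collect_eq
      proof (rule prob_bond_graph_mono)
        fix E assume E: "E \<subseteq> vertex_pairs W" and k_le: "k \<le> card (cluster (E \<union> star s N) S)"
        have "S = insert s (S - {s})" using s by auto
        hence eq: "cluster (E \<union> star s N) S = insert s (cluster E ((S - {s}) \<union> N))"
          using cluster_reveal_vertex[OF E sW] by metis
        have "cluster E ((S - {s}) \<union> N) \<subseteq> W"
          by (rule cluster_subset[OF E]) (use S N V in auto)
        thus "k' \<le> card (cluster E ((S - {s}) \<union> N))"
          using k_le eq k sW finW finite_subset[of _ W] by (auto simp: card_insert_if split: if_splits)
      qed
      also have "\<dots> \<le> m ^ card ((S - {s}) \<union> N) * a ^ k'"
      proof (rule Suc.hyps(1))
        show "(\<Sum>y\<in>W - {x}. p {x, y}) \<le> l" if "x \<in> W" for x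
          by (rule order_trans[OF sum_mono2 deg[of x]]) (use that fin p V sW in auto)
      qed (use cardW finW S N V p in auto)
      also have "\<dots> \<le> m ^ (card (S - {s}) + card (N \<inter> W)) * a ^ k'"
        using m a N by (intro mult_right_mono power_increasing) (auto simp: card_Un_le Int_absorb2)
      finally show "measure_pmf.prob (bond_graph W p) {E. E \<union> star s N \<in> {E. k \<le> card (cluster E S)}}
         \<le> m ^ card (S - {s}) * a ^ k' * m ^ card (N \<inter> W)" by (simp add: power_add mult_ac)
    next
      show "0 < m" "0 \<le> m ^ card (S - {s}) * a ^ k'" using m a(1) by simp_all
      show "0 \<le> p {s, y} \<and> p {s, y} \<le> 1" if "y \<in> W" for y
        by (rule p) (use that V sW in auto)
    qed
    also have "\<dots> \<le> (m ^ card (S - {s}) * a ^ k') * (m * a)"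
    proof (intro mult_left_mono order_trans[OF _ a(2)])
      have "(\<Sum>y\<in>W. p {s, y}) \<le> l" using deg[of s] s S unfolding W_def by blast
      thus "exp ((m - 1) * (\<Sum>y\<in>W. p {s, y})) \<le> exp ((m - 1) * l)"
        using m by (simp add: mult_left_mono)
    qed (use m a in auto)
    finally show ?thesis by (simp add: V[symmetric] cS k mult_ac)
  qed
qed

text \<open>A cluster contains its starting points: this ends the exploration below as soon as \<open>M\<close> vertices are
  active.\<close>
lemma prob_no_large_cluster_full:
  assumes "finite V" "S \<subseteq> V" "M \<le> card S"
  shows "measure_pmf.prob (bond_graph V p) {E. card (cluster E S) < M \<and> Q E} = 0"
proof -
  have "measure_pmf.prob (bond_graph V p) {E. card (cluster E S) < M \<and> Q E}
      \<le> measure_pmf.prob (bond_graph V p) {E. False}"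
  proof (rule prob_bond_graph_mono)
    fix E assume E: "E \<subseteq> vertex_pairs V" and less: "card (cluster E S) < M \<and> Q E"
    have "card S \<le> card (cluster E S)"
      by (intro card_mono subset_cluster finite_subset[OF cluster_subset[OF E assms(2)] assms(1)])
    thus False using less assms(3) by simp
  qed
  thus ?thesis by (simp add: measure_nonneg antisym)
qed

text \<open>The lower-tail companion of \<open>prob_cluster_ge\<close>, where \<open>V\<close> is the part of \<open>V0\<close> not yet explored and
  \<open>j\<close> the number of steps still to be made out of \<open>k\<close>. The potential \<open>m ^ card S * r ^ j / m ^ M\<close> is at
  least 1 at the end if fewer than \<open>M\<close> vertices are active; if \<open>M\<close> or more are active, the event is
  impossible. Each step preserves the bound because the explored or active vertices number at most \<open>M + k\<close>,
  so the remaining ones still carry degree \<open>l\<close>. If no vertex is active, any vertex may be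
  activated: its cluster is small on the event too, and the bound only improves by the factor \<open>m\<close>.\<close>
lemma prob_no_large_cluster:
  assumes "finite V" "S \<subseteq> V" "V \<subseteq> V0" "finite V0"
    and p: "\<And>x y. x \<in> V0 \<Longrightarrow> y \<in> V0 \<Longrightarrow> x \<noteq> y \<Longrightarrow> 0 \<le> p {x, y} \<and> p {x, y} \<le> 1"
    and deg: "\<And>x U. x \<in> U \<Longrightarrow> U \<subseteq> V0 \<Longrightarrow> card U \<le> M + k \<Longrightarrow> l \<le> (\<Sum>y\<in>V0 - U. p {x, y})"
    and m: "0 < m" "m \<le> 1" and r: "0 \<le> r" "exp ((m - 1) * l) \<le> m * r"
    and j: "card V + k = card V0 + j" and k: "k \<le> card V0"
  shows "measure_pmf.prob (bond_graph V p)
      {E. card (cluster E S) < M \<and> (\<forall>v\<in>V. card (cluster E {v}) < M)} * m ^ M \<le> m ^ card S * r ^ j"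
  using assms(1-3) j
proof (induction j arbitrary: V S)
  case 0
  have z: "measure_pmf.prob (bond_graph V p) {E. card (cluster E S) < M \<and> (\<forall>v\<in>V. card (cluster E {v}) < M)} = 0"
    if "M \<le> card S" using prob_no_large_cluster_full[OF 0(1,2) that, of p] .
  show ?case
  proof (cases "M \<le> card S")
    case False
    have "measure_pmf.prob (bond_graph V p) {E. card (cluster E S) < M \<and> (\<forall>v\<in>V. card (cluster E {v}) < M)} * m ^ M
      \<le> 1 * m ^ card S"
      using m False by (intro mult_mono power_decreasing) auto
    thus ?thesis by simp
  qed (use z m in auto)
next
  case (Suc j)
  note finV = Suc.prems(1) and S = Suc.prems(2) and V0 = Suc.prems(3) and cardV = Suc.prems(4)
  have nonempty: "measure_pmf.prob (bond_graph V p)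
      {E. card (cluster E S) < M \<and> (\<forall>v\<in>V. card (cluster E {v}) < M)} * m ^ M \<le> m ^ card S * r ^ Suc j"
    if s: "s \<in> S" and S: "S \<subseteq> V" for s S
  proof (cases "M \<le> card S")
    case True
    show ?thesis using prob_no_large_cluster_full[OF finV S True, of p] m r by simp
  next
    case False
    define W where "W = V - {s}"
    have V: "V = insert s W" and sW: "s \<notin> W" and finW: "finite W"
      using s S finV by (auto simp: W_def)
    define T where "T = W - S"
    have finS: "finite S" using finV S finite_subset by blast
    hence cS: "card S = Suc (card (S - {s}))" using s by (metis card.remove)
    have "measure_pmf.prob (bond_graph (insert s W) p)
          {E. card (cluster E S) < M \<and> (\<forall>v\<in>V. card (cluster E {v}) < M)}
        \<le> (m ^ card (S - {s}) * r ^ j / m ^ M) * exp ((m - 1) * (\<Sum>y\<in>T. p {s, y}))"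
    proof (rule bond_graph_reveal_vertex[OF finW sW])
      fix N assume N: "N \<subseteq> W"
      have "measure_pmf.prob (bond_graph W p) {E. E \<union> star s N \<in>
              {E. card (cluster E S) < M \<and> (\<forall>v\<in>V. card (cluster E {v}) < M)}}
          \<le> measure_pmf.prob (bond_graph W p)
              {E. card (cluster E ((S - {s}) \<union> N)) < M \<and> (\<forall>v\<in>W. card (cluster E {v}) < M)}"
        unfolding mem_Collect_eq
      proof (rule prob_bond_graph_mono, intro conjI ballI)
        fix E assume E: "E \<subseteq> vertex_pairs W"
          and small: "card (cluster (E \<union> star s N) S) < M \<and> (\<forall>v\<in>V. card (cluster (E \<union> star s N) {v}) < M)"
        have fin: "finite (cluster (E \<union> star s N) S')" if "S' \<subseteq> V" for S'
        proof (rule finite_subset[OF cluster_subset[OF _ that] finV])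
          show "E \<union> star s N \<subseteq> vertex_pairs V"
            using E N V vertex_pairs_insert[OF sW] by (auto simp: star_def)
        qed
        have "S = insert s (S - {s})" using s by auto
        hence "cluster (E \<union> star s N) S = insert s (cluster E ((S - {s}) \<union> N))"
          using cluster_reveal_vertex[OF E sW] by metis
        hence "card (cluster E ((S - {s}) \<union> N)) \<le> card (cluster (E \<union> star s N) S)"
          using fin[OF S] by (intro card_mono) auto
        thus "card (cluster E ((S - {s}) \<union> N)) < M" using small by simp
        fix v assume v: "v \<in> W"
        have "card (cluster E {v}) \<le> card (cluster (E \<union> star s N) {v})"
          using v V by (intro card_mono fin cluster_mono) auto
        thus "card (cluster E {v}) < M" using small v V by (metis insertI2 le_less_trans)
      qed
      also have "\<dots> \<le> m ^ card ((S - {s}) \<union> N) * r ^ j / m ^ M"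
        using Suc.IH[of W "(S - {s}) \<union> N"] cardV V sW finW N S V0 m(1)
        by (subst pos_le_divide_eq) auto
      also have "\<dots> \<le> m ^ card (S - {s}) * r ^ j / m ^ M * m ^ card (N \<inter> T)"
      proof -
        have "card ((S - {s}) \<union> (N \<inter> T)) = card (S - {s}) + card (N \<inter> T)"
          by (rule card_Un_disjoint) (use finS finW T_def in auto)
        moreover have "(S - {s}) \<union> (N \<inter> T) = (S - {s}) \<union> N" using N sW by (auto simp: T_def)
        ultimately show ?thesis by (simp add: power_add mult_ac)
      qed
      finally show "measure_pmf.prob (bond_graph W p) {E. E \<union> star s N \<in>
              {E. card (cluster E S) < M \<and> (\<forall>v\<in>V. card (cluster E {v}) < M)}}
          \<le> m ^ card (S - {s}) * r ^ j / m ^ M * m ^ card (N \<inter> T)" .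
    next
      show "T \<subseteq> W" "0 < m" "0 \<le> m ^ card (S - {s}) * r ^ j / m ^ M"
        using m(1) r(1) by (simp_all add: T_def)
      show "0 \<le> p {s, y} \<and> p {s, y} \<le> 1" if "y \<in> W" for y
        by (rule p) (use that V sW V0 in auto)
    qed
    also have "\<dots> \<le> (m ^ card (S - {s}) * r ^ j / m ^ M) * (m * r)"
    proof (intro mult_left_mono order_trans[OF _ r(2)])
      \<comment> \<open>explored or active vertices, from which no new vertex can be gained\<close>
      define U where "U = (V0 - V) \<union> S"
      have "card U \<le> card (V0 - V) + card S" unfolding U_def by (rule card_Un_le)
      also have "card (V0 - V) \<le> k" using cardV V0 finV by (subst card_Diff_subset) auto
      finally have "l \<le> (\<Sum>y\<in>V0 - U. p {s, y})"
        using False s S V0 by (intro deg) (auto simp: U_def)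
      also have "V0 - U = T" using V0 V s by (auto simp: U_def T_def)
      finally show "exp ((m - 1) * (\<Sum>y\<in>T. p {s, y})) \<le> exp ((m - 1) * l)"
        using m by (simp add: mult_left_mono_neg)
    qed (use m r in auto)
    finally show ?thesis using m by (simp add: V[symmetric] cS mult_ac field_simps)
  qed
  show ?case
  proof (cases "S = {}")
    case True
    have "card V \<noteq> 0" using cardV k by simp
    then obtain v where v: "v \<in> V" by fastforce
    have "measure_pmf.prob (bond_graph V p) {E. card (cluster E S) < M \<and> (\<forall>v\<in>V. card (cluster E {v}) < M)} * m ^ M
       \<le> measure_pmf.prob (bond_graph V p) {E. card (cluster E {v}) < M \<and> (\<forall>v\<in>V. card (cluster E {v}) < M)} * m ^ M"
      using m v by (intro mult_right_mono prob_bond_graph_mono) auto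
    also have "\<dots> \<le> m * r ^ Suc j" using nonempty[of v "{v}"] v by simp
    also have "\<dots> \<le> 1 * r ^ Suc j" using m r by (intro mult_right_mono) auto
    finally show ?thesis using True by simp
  qed (use nonempty S in auto)
qed

section \<open>Balls and spheres in the discrete torus\<close>

text \<open>The representatives of least absolute value; for even \<open>n\<close> the tie between \<open>n div 2\<close> and its
  negative is broken in favour of the positive one.\<close>
definition centred_residues :: "nat \<Rightarrow> int set" where
  "centred_residues n = {- int ((n - 1) div 2) .. int (n div 2)}"

definition translate :: "nat \<Rightarrow> nat \<Rightarrow> (nat \<Rightarrow> int) \<Rightarrow> (nat \<Rightarrow> int) \<Rightarrow> (nat \<Rightarrow> int) set" where
  "translate d n x v = torus_rel d n `` {\<lambda>i\<in>{..<d}. x i + v i}"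

lemma card_centred_residues: "1 \<le> n \<Longrightarrow> card (centred_residues n) = n"
  unfolding centred_residues_def by simp

lemma centred_residues_least:
  assumes "1 \<le> n" "v \<in> centred_residues n" "int n dvd w - v"
  shows "\<bar>v\<bar> \<le> \<bar>w\<bar>"
proof -
  obtain k where k: "w = v + int n * k" using assms(3) by (auto simp: dvd_def algebra_simps)
  have v: "2 * \<bar>v\<bar> \<le> int n" using assms(1,2) unfolding centred_residues_def by auto
  show ?thesis
  proof (cases "k = 0")
    case False
    hence "int n * 1 \<le> int n * \<bar>k\<bar>" by (intro mult_left_mono) auto
    hence "int n \<le> \<bar>int n * k\<bar>" by (simp add: abs_mult)
    thus ?thesis using v k by linarith
  qed (use k in simp)
qed

lemma centred_residues_unique:
  assumes "1 \<le> n" "v \<in> centred_residues n" "w \<in> centred_residues n" "int n dvd w - v"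
  shows "w = v"
proof (rule ccontr)
  assume "w \<noteq> v"
  hence "int n \<le> \<bar>w - v\<bar>" using assms(4) by (intro zdvd_imp_le) auto
  moreover have "\<bar>w - v\<bar> \<le> int ((n - 1) div 2) + int (n div 2)"
    using assms(2,3) unfolding centred_residues_def by (simp only: atLeastAtMost_iff) linarith
  ultimately show False using assms(1) by linarith
qed

lemma centred_residues_exists:
  assumes "1 \<le> n" shows "\<exists>v\<in>centred_residues n. int n dvd w - v"
proof -
  define c where "c = int ((n - 1) div 2)"
  define v where "v = (w + c) mod int n - c"
  have "w - v = int n * ((w + c) div int n)"
    using mult_div_mod_eq[of "int n" "w + c"] by (simp add: v_def algebra_simps)
  moreover have "v \<in> centred_residues n"
  proof -
    have "0 \<le> (w + c) mod int n" "(w + c) mod int n < int n" using assms by auto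
    moreover have "int n - 1 = c + int (n div 2)" using assms unfolding c_def by linarith
    ultimately show ?thesis
      unfolding centred_residues_def v_def c_def[symmetric] by (simp only: atLeastAtMost_iff) linarith
  qed
  ultimately show ?thesis by (metis dvd_triv_left)
qed

lemma equiv_torus_rel: "equiv (int_lattice d) (torus_rel d n)"
proof (rule equivI)
  show "trans (torus_rel d n)"
  proof (rule transI)
    fix x y z assume xy: "(x, y) \<in> torus_rel d n" and yz: "(y, z) \<in> torus_rel d n"
    have "int n dvd x i - z i" if "i < d" for i
    proof -
      have "int n dvd (x i - y i) + (y i - z i)"
        using xy yz that by (intro dvd_add) (auto simp: torus_rel_def)
      thus ?thesis by simp
    qed
    thus "(x, z) \<in> torus_rel d n" using xy yz by (auto simp: torus_rel_def)
  qed
  show "sym (torus_rel d n)" by (auto simp: torus_rel_def sym_def dvd_diff_commute)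
qed (auto simp: torus_rel_def refl_on_def)

context
  fixes d n :: nat and X :: "(nat \<Rightarrow> int) set" and x :: "nat \<Rightarrow> int"
  assumes d: "1 \<le> d" and n: "1 \<le> n"
    and x: "x \<in> int_lattice d" and X: "X = torus_rel d n `` {x}"
begin

text \<open>Coordinates centred at \<open>X\<close>: in them the torus is a box, and by the next lemma the distance to
  \<open>X\<close> is the maximum norm, so balls around \<open>X\<close> are smaller boxes.\<close>
lemma bij_betw_translate:
  "bij_betw (translate d n x) ({..<d} \<rightarrow>\<^sub>E centred_residues n) (torus d n)"
proof (rule bij_betwI')
  fix v w assume v: "v \<in> {..<d} \<rightarrow>\<^sub>E centred_residues n" and w: "w \<in> {..<d} \<rightarrow>\<^sub>E centred_residues n"
  show "(translate d n x v = translate d n x w) = (v = w)"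
  proof
    assume "translate d n x v = translate d n x w"
    hence "((\<lambda>i\<in>{..<d}. x i + v i), (\<lambda>i\<in>{..<d}. x i + w i)) \<in> torus_rel d n"
      unfolding translate_def by (subst (asm) eq_equiv_class_iff[OF equiv_torus_rel]) (auto simp: int_lattice_def)
    hence "int n dvd v i - w i" if "i < d" for i using that by (auto simp: torus_rel_def)
    hence "v i = w i" if "i < d" for i
      using that v w centred_residues_unique[OF n, of "w i" "v i"] by auto
    thus "v = w" using v w by (intro PiE_ext[of v _ _ w]) auto
  qed simp
next
  fix v assume "v \<in> {..<d} \<rightarrow>\<^sub>E centred_residues n"
  show "translate d n x v \<in> torus d n"
    unfolding translate_def torus_def by (rule quotientI) (auto simp: int_lattice_def)
next
  fix Y assume "Y \<in> torus d n"
  then obtain y where y: "y \<in> int_lattice d" "Y = torus_rel d n `` {y}"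
    unfolding torus_def by (rule quotientE)
  have "\<forall>i. \<exists>v\<in>centred_residues n. int n dvd (y i - x i) - v" using centred_residues_exists[OF n] by blast
  then obtain v where v: "\<And>i. v i \<in> centred_residues n" "\<And>i. int n dvd (y i - x i) - v i" by metis
  have "translate d n x (restrict v {..<d}) = Y"
    unfolding translate_def y(2)
  proof (subst eq_equiv_class_iff[OF equiv_torus_rel])
    have "int n dvd (x i + v i) - y i" for i
      using v(2)[of i] dvd_minus_iff[of "int n" "(y i - x i) - v i"] by (simp add: algebra_simps)
    thus "((\<lambda>i\<in>{..<d}. x i + restrict v {..<d} i), y) \<in> torus_rel d n"
      using y(1) by (auto simp: torus_rel_def int_lattice_def)
  qed (use y in \<open>auto simp: int_lattice_def\<close>)
  moreover have "restrict v {..<d} \<in> {..<d} \<rightarrow>\<^sub>E centred_residues n" using v(1) by auto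
  ultimately show "\<exists>v\<in>{..<d} \<rightarrow>\<^sub>E centred_residues n. Y = translate d n x v" by metis
qed

text \<open>The infimum over all pairs of representatives is attained at the centred difference, because
  its coordinates have least absolute value in their residue classes simultaneously.\<close>
lemma torus_dist_translate_le_iff:
  assumes v: "v \<in> {..<d} \<rightarrow>\<^sub>E centred_residues n"
  shows "torus_dist d X (translate d n x v) \<le> r \<longleftrightarrow> (\<forall>i<d. \<bar>v i\<bar> \<le> int r)"
proof -
  have ne: "{..<d} \<noteq> {}" using d by (auto simp: lessThan_empty_iff)
  define D where "D = {linf_dist d x' y | x' y. x' \<in> X \<and> y \<in> translate d n x v}"
  have lb: "Max ((\<lambda>i. nat \<bar>v i\<bar>) ` {..<d}) \<le> k" if kD: "k \<in> D" for k
  proof -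
    obtain x' y where k: "k = linf_dist d x' y" and x': "x' \<in> X" and y: "y \<in> translate d n x v"
      using kD unfolding D_def by blast
    have "nat \<bar>v i\<bar> \<le> nat \<bar>x' i - y i\<bar>" if i: "i < d" for i
    proof -
      have "int n dvd x i - x' i" using x' i by (auto simp: X torus_rel_def)
      moreover have "int n dvd (x i + v i) - y i" using y i by (auto simp: translate_def torus_rel_def)
      ultimately have "int n dvd (x i - x' i) - ((x i + v i) - y i)" by (rule dvd_diff)
      hence "int n dvd (y i - x' i) - v i" by (simp add: algebra_simps)
      hence "\<bar>v i\<bar> \<le> \<bar>y i - x' i\<bar>" using v i by (intro centred_residues_least[OF n]) auto
      thus ?thesis by (simp add: abs_minus_commute)
    qed
    also have "nat \<bar>x' i - y i\<bar> \<le> k" if "i < d" for i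
      unfolding k linf_dist_def using that by (intro Max_ge) auto
    finally show ?thesis using ne by (subst Max_le_iff) auto
  qed
  have "Max ((\<lambda>i. nat \<bar>v i\<bar>) ` {..<d}) \<in> D"
  proof -
    have "linf_dist d x (\<lambda>i\<in>{..<d}. x i + v i) = Max ((\<lambda>i. nat \<bar>v i\<bar>) ` {..<d})"
      unfolding linf_dist_def by (intro arg_cong[of _ _ Max] image_cong) auto
    moreover have "x \<in> X" using x unfolding X by (intro equiv_class_self[OF equiv_torus_rel])
    moreover have "(\<lambda>i\<in>{..<d}. x i + v i) \<in> translate d n x v"
      unfolding translate_def by (intro equiv_class_self[OF equiv_torus_rel]) (auto simp: int_lattice_def)
    ultimately show ?thesis unfolding D_def by force
  qed
  hence "torus_dist d X (translate d n x v) = Max ((\<lambda>i. nat \<bar>v i\<bar>) ` {..<d})"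
    unfolding torus_dist_def D_def[symmetric] using lb by (intro cInf_eq_minimum)
  thus ?thesis using ne by (auto simp: nat_le_iff)
qed

lemma card_torus_ball_aux:
  assumes "2 * r + 1 \<le> n"
  shows "card {Y \<in> torus d n. torus_dist d X Y \<le> r} = (2 * r + 1) ^ d"
proof -
  have "bij_betw (translate d n x) {v \<in> {..<d} \<rightarrow>\<^sub>E centred_residues n. torus_dist d X (translate d n x v) \<le> r}
      {Y \<in> torus d n. torus_dist d X Y \<le> r}"
    by (rule bij_betw_Collect[OF bij_betw_translate]) simp
  hence "card {Y \<in> torus d n. torus_dist d X Y \<le> r} =
      card {v \<in> {..<d} \<rightarrow>\<^sub>E centred_residues n. torus_dist d X (translate d n x v) \<le> r}"
    using bij_betw_same_card by fastforce
  also have "{v \<in> {..<d} \<rightarrow>\<^sub>E centred_residues n. torus_dist d X (translate d n x v) \<le> r}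
     = {..<d} \<rightarrow>\<^sub>E {- int r .. int r}"
  proof -
    have "{- int r .. int r} \<subseteq> centred_residues n" using assms by (auto simp: centred_residues_def)
    hence sub: "{..<d} \<rightarrow>\<^sub>E {- int r .. int r} \<subseteq> {..<d} \<rightarrow>\<^sub>E centred_residues n"
      by (intro PiE_mono)
    have "torus_dist d X (translate d n x v) \<le> r \<longleftrightarrow> v \<in> {..<d} \<rightarrow>\<^sub>E {- int r .. int r}"
      if v: "v \<in> {..<d} \<rightarrow>\<^sub>E centred_residues n" for v
      unfolding torus_dist_translate_le_iff[OF v] using v by (force simp: PiE_iff abs_le_iff)
    thus ?thesis using sub by blast
  qed
  also have "card \<dots> = (2 * r + 1) ^ d"
  proof -
    have "card {- int r .. int r} = 2 * r + 1" by simp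
    thus ?thesis by (simp only: card_PiE finite_lessThan prod_constant card_lessThan)
  qed
  finally show ?thesis .
qed

lemma torus_dist_le_diam_aux:
  assumes "Y \<in> torus d n" shows "torus_dist d X Y \<le> n div 2"
proof -
  obtain v where v: "v \<in> {..<d} \<rightarrow>\<^sub>E centred_residues n" "Y = translate d n x v"
    using assms bij_betw_translate unfolding bij_betw_def by blast
  have "\<forall>i<d. v i \<in> centred_residues n" using v(1) by auto
  thus ?thesis unfolding v(2) torus_dist_translate_le_iff[OF v(1)]
    by (force simp: centred_residues_def)
qed

lemma card_torus_aux: "card (torus d n) = n ^ d"
  using bij_betw_same_card[OF bij_betw_translate] by (simp add: card_PiE card_centred_residues[OF n])

end

lemma torus_representative:
  assumes "X \<in> torus d n"
  obtains x where "x \<in> int_lattice d" "X = torus_rel d n `` {x}"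
  using assms unfolding torus_def by (rule quotientE)

lemma card_torus: "1 \<le> d \<Longrightarrow> 1 \<le> n \<Longrightarrow> card (torus d n) = n ^ d"
  by (rule card_torus_aux[of _ _ "\<lambda>i\<in>{..<d}. 0"]) (auto simp: int_lattice_def)

lemma finite_torus: "1 \<le> d \<Longrightarrow> 1 \<le> n \<Longrightarrow> finite (torus d n)"
  using card_torus[of d n] by (auto intro: card_ge_0_finite)

lemma card_torus_ball:
  "1 \<le> d \<Longrightarrow> X \<in> torus d n \<Longrightarrow> 2 * r + 1 \<le> n \<Longrightarrow>
    card {Y \<in> torus d n. torus_dist d X Y \<le> r} = (2 * r + 1) ^ d"
  by (erule torus_representative) (rule card_torus_ball_aux, auto)

lemma torus_dist_le_diam:
  "1 \<le> d \<Longrightarrow> 1 \<le> n \<Longrightarrow> X \<in> torus d n \<Longrightarrow> Y \<in> torus d n \<Longrightarrow> torus_dist d X Y \<le> torus_diam n"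
  unfolding torus_diam_def by (rule torus_representative[of X d n]) (auto intro: torus_dist_le_diam_aux)

lemma torus_dist_commute: "torus_dist d X Y = torus_dist d Y X"
proof -
  have "linf_dist d x y = linf_dist d y x" for x y
    unfolding linf_dist_def by (simp add: abs_minus_commute)
  hence "{linf_dist d x y | x y. x \<in> X \<and> y \<in> Y} = {linf_dist d x y | x y. x \<in> Y \<and> y \<in> X}" by blast
  thus ?thesis by (simp add: torus_dist_def)
qed

lemma torus_dist_self:
  assumes "1 \<le> d" "X \<in> torus d n" shows "torus_dist d X X = 0"
proof -
  obtain x where "x \<in> int_lattice d" "X = torus_rel d n `` {x}" using assms(2) by (rule torus_representative)
  hence "x \<in> X" using equiv_class_self[OF equiv_torus_rel] by simp
  hence "linf_dist d x x \<in> {linf_dist d x y | x y. x \<in> X \<and> y \<in> X}" by blast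
  moreover have "linf_dist d x x = 0"
    using assms(1) by (auto simp: linf_dist_def image_constant_conv lessThan_empty_iff)
  ultimately show ?thesis unfolding torus_dist_def by (metis (lifting) cInf_lower bot_nat_0.extremum_uniqueI bdd_below_bot)
qed

lemma torus_dist_pos:
  assumes "1 \<le> d" "1 \<le> n" "X \<in> torus d n" "Y \<in> torus d n" "X \<noteq> Y"
  shows "1 \<le> torus_dist d X Y"
proof (rule ccontr)
  assume "\<not> 1 \<le> torus_dist d X Y"
  \<comment> \<open>the ball of radius 0 has a single point\<close>
  hence "{X, Y} \<subseteq> {Z \<in> torus d n. torus_dist d X Z \<le> 0}" using assms torus_dist_self by auto
  from card_mono[OF _ this] show False
    using card_torus_ball[OF assms(1,3), of 0] finite_torus[OF assms(1,2)] assms(2,5) by simp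
qed

text \<open>The weights are those in the equation for \<open>\<zeta>\<close>: spheres are differences of consecutive balls. Only the
  outermost sphere needs separate treatment, since its ball is the whole torus.\<close>
lemma sum_over_torus_spheres:
  fixes f :: "nat \<Rightarrow> real"
  assumes d: "1 \<le> d" and n: "2 \<le> n" and X: "X \<in> torus d n" and f0: "f 0 = 0"
  shows "(\<Sum>Y\<in>torus d n. f (torus_dist d X Y)) =
    (\<Sum>i = 1..torus_diam n - 1. ((2 * real i + 1) ^ d - (2 * real i - 1) ^ d) * f i)
     + (real n ^ d - (2 * real (torus_diam n) - 1) ^ d) * f (torus_diam n)"
proof -
  let ?T = "torus d n" and ?D = "torus_diam n"
  have fin: "finite ?T" using finite_torus d n by auto
  have D: "1 \<le> ?D" "2 * ?D \<le> n" using n by (auto simp: torus_diam_def)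
  have ball: "real (card {Y \<in> ?T. torus_dist d X Y \<le> r}) = (2 * real r + 1) ^ d" if "2 * r + 1 \<le> n" for r
    using card_torus_ball[OF d X that] by (simp add: add.commute)
  have sphere: "card {Y \<in> ?T. torus_dist d X Y = i} =
      real (card {Y \<in> ?T. torus_dist d X Y \<le> i}) - real (card {Y \<in> ?T. torus_dist d X Y \<le> i - 1})"
    if "1 \<le> i" for i
  proof -
    have "{Y \<in> ?T. torus_dist d X Y = i} = {Y \<in> ?T. torus_dist d X Y \<le> i} - {Y \<in> ?T. torus_dist d X Y \<le> i - 1}"
      using that by auto
    moreover have "card \<dots> = card {Y \<in> ?T. torus_dist d X Y \<le> i} - card {Y \<in> ?T. torus_dist d X Y \<le> i - 1}"
      by (rule card_Diff_subset) (use fin in auto)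
    moreover have "card {Y \<in> ?T. torus_dist d X Y \<le> i - 1} \<le> card {Y \<in> ?T. torus_dist d X Y \<le> i}"
      by (rule card_mono) (use fin in auto)
    ultimately show ?thesis by simp
  qed
  have "(\<Sum>Y\<in>?T. f (torus_dist d X Y)) = (\<Sum>i\<in>{0..?D}. \<Sum>Y | Y \<in> ?T \<and> torus_dist d X Y = i. f (torus_dist d X Y))"
    by (rule sum.group[symmetric]) (use fin torus_dist_le_diam d n X in auto)
  also have "\<dots> = (\<Sum>i\<in>{0..?D}. real (card {Y \<in> ?T. torus_dist d X Y = i}) * f i)"
    by (intro sum.cong refl) simp
  also have "\<dots> = (\<Sum>i = 1..?D. real (card {Y \<in> ?T. torus_dist d X Y = i}) * f i)"
    using f0 by (simp add: sum.atLeast_Suc_atMost)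
  also have "{1..?D} = insert ?D {1..?D - 1}" using D by auto
  also have "(\<Sum>i\<in>\<dots>. real (card {Y \<in> ?T. torus_dist d X Y = i}) * f i) =
     (\<Sum>i = 1..?D - 1. real (card {Y \<in> ?T. torus_dist d X Y = i}) * f i)
      + real (card {Y \<in> ?T. torus_dist d X Y = ?D}) * f ?D"
    using D by (subst sum.insert) auto
  also have "real (card {Y \<in> ?T. torus_dist d X Y = ?D}) = real n ^ d - (2 * real ?D - 1) ^ d"
  proof -
    have "{Y \<in> ?T. torus_dist d X Y \<le> ?D} = ?T" using torus_dist_le_diam d n X by auto
    thus ?thesis using ball[of "?D - 1"] D sphere[of ?D] card_torus[of d n] d n by (simp add: of_nat_diff)
  qed
  also have "(\<Sum>i = 1..?D - 1. real (card {Y \<in> ?T. torus_dist d X Y = i}) * f i) =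
      (\<Sum>i = 1..?D - 1. ((2 * real i + 1) ^ d - (2 * real i - 1) ^ d) * f i)"
  proof (intro sum.cong refl)
    fix i assume i: "i \<in> {1..?D - 1}"
    hence le: "1 \<le> i" "2 * i + 1 \<le> n" "2 * (i - 1) + 1 \<le> n" using D by auto
    have "2 * real (i - 1) + 1 = 2 * real i - 1" using le by (simp add: of_nat_diff)
    thus "real (card {Y \<in> ?T. torus_dist d X Y = i}) * f i = ((2 * real i + 1) ^ d - (2 * real i - 1) ^ d) * f i"
      using sphere[OF le(1)] ball[OF le(2)] ball[OF le(3)] by simp
  qed
  finally show ?thesis .
qed

section \<open>The normalising constant\<close>

text \<open>The weights of the spheres add up to \<open>n ^ d - 1\<close>, the number of vertices other than \<open>X\<close>, so the
  defining equation is the normalisation of the expected degree of \<open>X\<close>.\<close>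
lemma zeta_eq_iff:
  assumes d: "1 \<le> d" and n: "3 \<le> n" and X: "X \<in> torus d n" and \<rho>0: "\<rho> 0 = 0"
  shows "zeta_eq d \<rho> n z \<longleftrightarrow>
    (\<Sum>Y\<in>torus d n. 1 - exp (- inverse z * \<rho> (real (torus_dist d X Y)))) = 1"
proof -
  let ?T = "torus d n" and ?D = "torus_diam n"
  let ?w = "\<lambda>i::nat. (2 * real i + 1) ^ d - (2 * real i - 1) ^ d" and ?w' = "real n ^ d - (2 * real ?D - 1) ^ d"
  let ?e = "\<lambda>i::nat. exp (- inverse z * \<rho> (real i))"
  have n2: "2 \<le> n" and n1: "1 \<le> n" using n by auto
  have D: "?D \<noteq> 0" using n by (auto simp: torus_diam_def)
  have "real (n ^ d) - 1 = (\<Sum>Y\<in>?T. if torus_dist d X Y = 0 then 0 else 1)"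
  proof -
    have "(\<Sum>Y\<in>?T. if torus_dist d X Y = 0 then 0 else (1::real)) = (\<Sum>Y\<in>?T - {X}. 1)"
      using finite_torus[OF d n1] X torus_dist_self[OF d X] torus_dist_pos[OF d n1 X]
      by (intro sum.mono_neutral_cong_right) fastforce+
    thus ?thesis using finite_torus[OF d n1] X n1 by (simp add: card_torus[OF d n1] of_nat_diff)
  qed
  also have "\<dots> = (\<Sum>i = 1..?D - 1. ?w i) + ?w'"
    using sum_over_torus_spheres[OF d n2 X, of "\<lambda>i. if i = 0 then 0 else 1"] D by simp
  finally have total: "(\<Sum>i = 1..?D - 1. ?w i) + ?w' = real n ^ d - 1" by simp
  have "(\<Sum>Y\<in>?T. 1 - ?e (torus_dist d X Y)) = (\<Sum>i = 1..?D - 1. ?w i * (1 - ?e i)) + ?w' * (1 - ?e ?D)"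
    using sum_over_torus_spheres[OF d n2 X, of "\<lambda>i. 1 - ?e i"] \<rho>0 by simp
  also have "\<dots> = ((\<Sum>i = 1..?D - 1. ?w i) + ?w') - ((\<Sum>i = 1..?D - 1. ?w i * ?e i) + ?w' * ?e ?D)"
    by (simp add: right_diff_distrib sum_subtractf)
  also have "\<dots> = (real n ^ d - 1) - ((\<Sum>i = 1..?D - 1. ?w i * ?e i) + ?w' * ?e ?D)"
    unfolding total ..
  finally show ?thesis unfolding zeta_eq_def by linarith
qed

lemma power_law_lower:
  assumes "power_law_profile A1 A2 \<alpha> \<rho>" "0 < \<alpha>" "0 < A1" "1 \<le> i" "i \<le> n"
  shows "A1 * real n powr - \<alpha> \<le> \<rho> (real i)"
proof -
  have "A1 * real n powr - \<alpha> \<le> A1 * real i powr - \<alpha>"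
    using assms by (intro mult_left_mono powr_mono2') auto
  also have "\<dots> \<le> \<rho> (real i)" using assms by (auto simp: power_law_profile_def)
  finally show ?thesis .
qed

lemma power_law_upper:
  assumes "power_law_profile A1 A2 \<alpha> \<rho>" "0 < \<alpha>" "0 \<le> A2" "0 < a" "a \<le> i" "1 \<le> i"
  shows "\<rho> i \<le> A2 * a powr - \<alpha>"
proof -
  have "\<rho> i \<le> A2 * i powr - \<alpha>" using assms by (auto simp: power_law_profile_def)
  also have "\<dots> \<le> A2 * a powr - \<alpha>" using assms by (intro mult_left_mono powr_mono2') auto
  finally show ?thesis .
qed

lemma power_law_dist_lower:
  assumes d: "1 \<le> d" and n: "1 \<le> n" and XY: "X \<in> torus d n" "Y \<in> torus d n" "X \<noteq> Y"
    and \<rho>: "power_law_profile A1 A2 \<alpha> \<rho>" and \<alpha>: "0 < \<alpha>" and A: "0 < A1"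
  shows "A1 * real n powr - \<alpha> \<le> \<rho> (real (torus_dist d X Y))"
  using torus_dist_le_diam[OF d n XY(1,2)] torus_dist_pos[OF d n XY] 
  by (intro power_law_lower[OF \<rho> \<alpha> A]) (auto simp: torus_diam_def)

lemma card_torus_ge: 
  assumes "1 \<le> d" "3 \<le> n" shows "3 \<le> real n ^ d"
proof -
  have "3 \<le> real n ^ 1" using assms by simp
  also have "\<dots> \<le> real n ^ d" using assms by (intro power_increasing) auto
  finally show ?thesis .
qed

lemma torus_nonempty:
  assumes "1 \<le> d" "1 \<le> n" obtains X where "X \<in> torus d n"
proof -
  have "card (torus d n) \<noteq> 0" using card_torus[OF assms] assms by simp
  thus ?thesis using that by fastforce
qed

lemma sum_others_ge:
  fixes f :: "_ \<Rightarrow> real"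
  assumes d: "1 \<le> d" and n: "1 \<le> n" and X: "X \<in> torus d n" and f0: "0 \<le> f X"
    and f: "\<And>Y. Y \<in> torus d n \<Longrightarrow> Y \<noteq> X \<Longrightarrow> b \<le> f Y"
  shows "(real n ^ d - 1) * b \<le> sum f (torus d n)"
proof -
  have "(real n ^ d - 1) * b = (\<Sum>Y\<in>torus d n - {X}. b)"
    using X finite_torus[OF d n] n by (simp add: card_torus[OF d n] of_nat_diff)
  also have "\<dots> \<le> (\<Sum>Y\<in>torus d n - {X}. f Y)" using f by (intro sum_mono) auto
  also have "\<dots> \<le> sum f (torus d n)" using finite_torus[OF d n] f0 X by (simp add: sum_diff1)
  finally show ?thesis .
qed

text \<open>As a function of \<open>c = inverse z\<close> the expected degree is continuous and strictly increasing, vanishes at 0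
  and exceeds 1 for large \<open>c\<close>, because there are at least two other vertices.\<close>
lemma zeta_well_defined:
  assumes d: "1 \<le> d" and n: "3 \<le> n" and \<rho>: "power_law_profile A1 A2 \<alpha> \<rho>" and \<alpha>: "0 < \<alpha>" and A: "0 < A1"
  shows "0 < zeta d \<rho> n \<and> zeta_eq d \<rho> n (zeta d \<rho> n)"
proof -
  have n1: "1 \<le> n" using n by simp
  obtain X where X: "X \<in> torus d n" using torus_nonempty[OF d n1] .
  have \<rho>0: "\<rho> 0 = 0" using \<rho> by (auto simp: power_law_profile_def)
  have \<rho>_nonneg: "0 \<le> \<rho> (real k)" for k using \<rho> by (auto simp: power_law_profile_def)
  \<comment> \<open>the expected degree of \<open>X\<close> as a function of \<open>c = inverse z\<close>\<close>
  define h where "h c = (\<Sum>Y\<in>torus d n. 1 - exp (- c * \<rho> (real (torus_dist d X Y))))" for c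
  define b where "b = A1 * real n powr - \<alpha>"
  have b: "0 < b" using A n by (simp add: b_def)
  have b_le: "b \<le> \<rho> (real (torus_dist d X Y))" if "Y \<in> torus d n" "Y \<noteq> X" for Y
    unfolding b_def using power_law_dist_lower[OF d n1 X that(1) _ \<rho> \<alpha> A] that(2) by auto
  have "h 0 \<le> 1" by (simp add: h_def)
  \<comment> \<open>at \<open>c = ln 2 / b\<close> each of the other vertices is a neighbour with probability at least \<open>1 / 2\<close>\<close>
  moreover have "1 \<le> h (ln 2 / b)"
  proof -
    have "1 \<le> (real n ^ d - 1) * (1 / 2)" using card_torus_ge[OF d n] by simp
    also have "\<dots> \<le> h (ln 2 / b)"
      unfolding h_def
    proof (rule sum_others_ge[OF d n1 X])
      fix Y assume Y: "Y \<in> torus d n" "Y \<noteq> X"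
      have "ln 2 / b * b \<le> ln 2 / b * \<rho> (real (torus_dist d X Y))"
        using b_le[OF Y] b by (intro mult_left_mono) auto
      hence "exp (- (ln 2 / b) * \<rho> (real (torus_dist d X Y))) \<le> exp (- ln 2)"
        using b by simp
      also have "\<dots> = 1 / 2" by (simp add: exp_minus)
      finally show "1 / 2 \<le> 1 - exp (- (ln 2 / b) * \<rho> (real (torus_dist d X Y)))" by simp
    qed (use b \<rho>_nonneg in simp)
    finally show ?thesis .
  qed
  moreover have "continuous_on {0..ln 2 / b} h" unfolding h_def by (intro continuous_intros)
  ultimately obtain c where c: "0 \<le> c" "h c = 1"
    using IVT'[of h 0 1 "ln 2 / b"] b by auto
  have "c \<noteq> 0" using c by (auto simp: h_def)
  hence "0 < c" using c by simp
  obtain Y where Y: "Y \<in> torus d n" "Y \<noteq> X"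
  proof -
    have "card (torus d n - {X}) \<noteq> 0"
      using X finite_torus[OF d n1] card_torus_ge[OF d n] by (simp add: card_torus[OF d n1] flip: of_nat_power)
    thus ?thesis using that by (metis card.empty Diff_iff ex_in_conv singletonI)
  qed
  have mono: "h c1 < h c2" if "c1 < c2" for c1 c2
    unfolding h_def
  proof (rule sum_strict_mono_ex1)
    show "\<forall>Y\<in>torus d n. 1 - exp (- c1 * \<rho> (real (torus_dist d X Y))) \<le> 1 - exp (- c2 * \<rho> (real (torus_dist d X Y)))"
      using that \<rho>_nonneg by (auto intro!: mult_right_mono)
    have "1 - exp (- c1 * \<rho> (real (torus_dist d X Y))) < 1 - exp (- c2 * \<rho> (real (torus_dist d X Y)))"
      using that b b_le[OF Y] by simp
    thus "\<exists>Y\<in>torus d n. 1 - exp (- c1 * \<rho> (real (torus_dist d X Y))) < 1 - exp (- c2 * \<rho> (real (torus_dist d X Y)))"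
      using Y by blast
  qed (use finite_torus[OF d n1] in auto)
  have iff: "zeta_eq d \<rho> n z \<longleftrightarrow> h (inverse z) = 1" for z
    using zeta_eq_iff[OF d n X, of \<rho> z] \<rho>0 unfolding h_def by blast
  have inj: "h c1 = 1 \<Longrightarrow> h c2 = 1 \<Longrightarrow> c1 = c2" for c1 c2
    using mono[of c1 c2] mono[of c2 c1] by linarith
  have "\<exists>!z. 0 < z \<and> zeta_eq d \<rho> n z"
  proof (rule ex1I[of _ "inverse c"])
    fix z assume "0 < z \<and> zeta_eq d \<rho> n z"
    hence "inverse z = c" using inj c iff by blast
    thus "z = inverse c" by auto
  qed (use c \<open>0 < c\<close> iff in auto)
  thus ?thesis unfolding zeta_def by (rule theI')
qed

context
  fixes d n :: nat and \<rho> :: "real \<Rightarrow> real" and A1 A2 \<alpha> :: real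
  assumes d: "1 \<le> d" and n: "3 \<le> n" and \<rho>: "power_law_profile A1 A2 \<alpha> \<rho>"
    and \<alpha>: "0 < \<alpha>" and A1: "0 < A1" and A2: "A1 \<le> A2"
begin

lemma zeta_pos: "0 < zeta d \<rho> n"
  using zeta_well_defined[OF d n \<rho> \<alpha> A1] by simp

lemma expected_degree_eq_1:
  assumes "X \<in> torus d n"
  shows "(\<Sum>Y\<in>torus d n. 1 - exp (- (inverse (zeta d \<rho> n) * \<rho> (real (torus_dist d X Y))))) = 1"
  using zeta_well_defined[OF d n \<rho> \<alpha> A1] zeta_eq_iff[OF d n assms, of \<rho>] \<rho>
  by (auto simp: power_law_profile_def)

text \<open>Let \<open>N = n ^ d\<close>. All \<open>N - 1\<close> other vertices are within distance \<open>n\<close>, so each of them has weight at least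
  \<open>u = inverse \<zeta> * A1 * n powr (- \<alpha>)\<close>. An expected degree of 1 thus forces \<open>(N - 1) (1 - exp (- u)) \<le> 1\<close>,
  which makes \<open>u\<close> at most \<open>1 / (N - 2)\<close>.\<close>
lemma inverse_zeta_le: "inverse (zeta d \<rho> n) \<le> 3 / A1 * real n powr (\<alpha> - real d)"
proof -
  have n1: "1 \<le> n" using n by simp
  let ?N = "real n ^ d" and ?z = "zeta d \<rho> n"
  obtain X where X: "X \<in> torus d n" using torus_nonempty[OF d n1] .
  have N: "3 \<le> ?N" by (rule card_torus_ge[OF d n])
  define u where "u = inverse ?z * (A1 * real n powr - \<alpha>)"
  have "(?N - 1) * (1 - exp (- u))
      \<le> (\<Sum>Y\<in>torus d n. 1 - exp (- (inverse ?z * \<rho> (real (torus_dist d X Y)))))"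
  proof (rule sum_others_ge[OF d n1 X])
    show "0 \<le> 1 - exp (- (inverse ?z * \<rho> (real (torus_dist d X X))))"
      using \<rho> zeta_pos by (auto simp: power_law_profile_def)
    fix Y assume "Y \<in> torus d n" "Y \<noteq> X"
    hence "A1 * real n powr - \<alpha> \<le> \<rho> (real (torus_dist d X Y))"
      using power_law_dist_lower[OF d n1 X _ _ \<rho> \<alpha> A1] by auto
    thus "1 - exp (- u) \<le> 1 - exp (- (inverse ?z * \<rho> (real (torus_dist d X Y))))"
      using zeta_pos by (auto simp: u_def intro!: mult_left_mono)
  qed
  hence "(?N - 2) \<le> (?N - 1) * exp (- u)" unfolding expected_degree_eq_1[OF X] by (simp add: algebra_simps)
  hence "(?N - 2) * exp u \<le> (?N - 1) * exp (- u) * exp u" by (intro mult_right_mono) auto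
  also have "\<dots> = ?N - 1" by (simp add: exp_minus)
  finally have "(?N - 2) * exp u \<le> ?N - 1" .
  moreover have "(?N - 2) * (1 + u) \<le> (?N - 2) * exp u"
    using N by (intro mult_left_mono) (auto simp: add.commute)
  ultimately have "(?N - 2) * u \<le> 1" by (simp add: algebra_simps)
  moreover have "?N / 3 * u \<le> (?N - 2) * u"
    using N zeta_pos A1 by (intro mult_right_mono) (auto simp: u_def)
  ultimately have "?N * u \<le> 3" by simp
  moreover have "real n powr - \<alpha> * ?N * real n powr (\<alpha> - real d) = 1"
    using n by (simp add: powr_realpow[symmetric] powr_add[symmetric])
  moreover have "?N * u * (real n powr (\<alpha> - real d) / A1)
      = inverse ?z * (real n powr - \<alpha> * ?N * real n powr (\<alpha> - real d))"
    using A1 by (simp add: u_def)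
  moreover have "?N * u * (real n powr (\<alpha> - real d) / A1) \<le> 3 * (real n powr (\<alpha> - real d) / A1)"
    using \<open>?N * u \<le> 3\<close> A1 by (intro mult_right_mono) auto
  ultimately show ?thesis by simp
qed

lemma rate_le:
  "inverse (zeta d \<rho> n) * \<rho> (real k) \<le> 3 * A2 / A1 * real n powr (\<alpha> - real d)"
proof -
  have "\<rho> (real k) \<le> A2"
  proof (cases "k = 0")
    case True thus ?thesis using \<rho> A1 A2 by (auto simp: power_law_profile_def)
  next
    case False
    thus ?thesis using power_law_upper[OF \<rho> \<alpha>, of 1 "real k"] A1 A2 by simp
  qed
  hence "inverse (zeta d \<rho> n) * \<rho> (real k) \<le> (3 / A1 * real n powr (\<alpha> - real d)) * A2"
    using inverse_zeta_le zeta_pos A1 A2 \<rho>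
    by (intro mult_mono) (auto simp: power_law_profile_def)
  thus ?thesis by (simp add: field_simps)
qed

end

section \<open>Edge probabilities near criticality\<close>

text \<open>The product of the right-hand side with the Taylor bound \<open>1 + x + x\<^sup>2 / 2 \<le> exp x\<close> is \<open>1 + x ^ 4 / 4\<close>.\<close>
lemma exp_minus_le_quadratic: "0 \<le> (x::real) \<Longrightarrow> exp (- x) \<le> 1 - x + x\<^sup>2 / 2"
proof -
  assume x: "0 \<le> x"
  have "1 \<le> 1 + x ^ 4 / 4" by simp
  also have "\<dots> = (1 - x + x\<^sup>2 / 2) * (1 + x + x\<^sup>2 / 2)"
    by (simp add: power2_eq_square power4_eq_xxxx field_simps)
  also have "\<dots> \<le> (1 - x + x\<^sup>2 / 2) * exp x"
  proof (intro mult_left_mono exp_lower_Taylor_quadratic x)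
    have "0 \<le> ((1 - x)\<^sup>2 + 1) / 2" by simp
    also have "\<dots> = 1 - x + x\<^sup>2 / 2" by (simp add: power2_eq_square field_simps)
    finally show "0 \<le> 1 - x + x\<^sup>2 / 2" .
  qed
  finally show ?thesis by (simp add: exp_minus field_simps)
qed

text \<open>Concavity of \<open>1 - exp (- w)\<close> works against this bound, so the second-order error has to be absorbed by
  spending half of \<open>\<epsilon>\<close>. The argument uses \<open>1 - \<epsilon> \<le> (1 - \<epsilon> / 2)\<^sup>2\<close>.\<close>
lemma thinned_prob_le:
  fixes w \<epsilon> :: real
  assumes "0 \<le> w" "w \<le> \<epsilon>" "\<epsilon> < 1"
  shows "1 - exp (- ((1 - \<epsilon>) * w)) \<le> (1 - \<epsilon> / 2) * (1 - exp (- w))"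
proof -
  have "1 - exp (- ((1 - \<epsilon>) * w)) \<le> (1 - \<epsilon>) * w"
    using exp_ge_add_one_self[of "- ((1 - \<epsilon>) * w)"] by simp
  also have "\<dots> \<le> (1 - \<epsilon> / 2) * ((1 - \<epsilon> / 2) * w)"
    using assms by (simp add: algebra_simps)
  also have "\<dots> \<le> (1 - \<epsilon> / 2) * (w - w\<^sup>2 / 2)"
  proof (rule mult_left_mono)
    have "w * w \<le> \<epsilon> * w" using assms by (intro mult_right_mono) auto
    thus "(1 - \<epsilon> / 2) * w \<le> w - w\<^sup>2 / 2" by (simp add: algebra_simps power2_eq_square)
  qed (use assms in auto)
  also have "\<dots> \<le> (1 - \<epsilon> / 2) * (1 - exp (- w))"
    using assms exp_minus_le_quadratic[of w] by (intro mult_left_mono) auto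
  finally show ?thesis .
qed

lemma boosted_prob_ge:
  fixes w \<epsilon> :: real
  assumes "0 \<le> w" "w \<le> \<epsilon> / (1 + \<epsilon>)\<^sup>2" "0 < \<epsilon>"
  shows "(1 + \<epsilon> / 2) * (1 - exp (- w)) \<le> 1 - exp (- ((1 + \<epsilon>) * w))"
proof -
  have "(1 + \<epsilon> / 2) * (1 - exp (- w)) \<le> (1 + \<epsilon> / 2) * w"
    using exp_ge_add_one_self[of "- w"] assms by (intro mult_left_mono) auto
  also have "\<dots> \<le> (1 + \<epsilon>) * w - ((1 + \<epsilon>) * w)\<^sup>2 / 2"
  proof -
    have "(1 + \<epsilon>)\<^sup>2 * w \<le> \<epsilon>" using assms by (simp add: field_simps)
    hence "((1 + \<epsilon>)\<^sup>2 * w) * w \<le> \<epsilon> * w" using assms by (intro mult_right_mono) auto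
    moreover have "((1 + \<epsilon>) * w)\<^sup>2 = ((1 + \<epsilon>)\<^sup>2 * w) * w" by (simp add: power2_eq_square)
    moreover have "(1 + \<epsilon> / 2) * w = w + \<epsilon> * w / 2" "(1 + \<epsilon>) * w = w + \<epsilon> * w" by (simp_all add: algebra_simps)
    ultimately show ?thesis by linarith
  qed
  also have "\<dots> \<le> 1 - exp (- ((1 + \<epsilon>) * w))"
    using exp_minus_le_quadratic[of "(1 + \<epsilon>) * w"] assms by simp
  finally show ?thesis .
qed

section \<open>Small sets carry little weight\<close>

text \<open>A discrete form of \<open>s x powr (s - 1) = d/dx x powr s\<close>. For \<open>s < 1\<close> it is the tangent-line bound
  \<open>(1 - 1/x) powr s \<le> 1 - s/x\<close>, an instance of Young's inequality.\<close>
lemma powr_increment_ge: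
  fixes x s :: real
  assumes x: "1 \<le> x" and s: "0 < s"
  shows "min 1 s * x powr (s - 1) \<le> x powr s - (x - 1) powr s"
proof (cases "1 \<le> s")
  case True
  have "(x - 1) powr s = (x - 1) * (x - 1) powr (s - 1)"
    using x s by (cases "x = 1") (auto simp: powr_diff)
  also have "\<dots> \<le> (x - 1) * x powr (s - 1)"
    using x True by (intro mult_left_mono powr_mono2) auto
  also have "\<dots> = x powr s - x powr (s - 1)"
    using x by (simp add: powr_diff field_simps)
  finally show ?thesis using True by simp
next
  case False
  show ?thesis
  proof (cases "x = 1")
    case True thus ?thesis using False s by simp
  next
    case x1: False
    have "(1 - 1 / x) powr s * 1 powr (1 - s) \<le> s * (1 - 1 / x) + (1 - s) * 1"
      using x x1 False s by (intro Youngs_inequality_0) auto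
    hence "x powr s * (1 - 1 / x) powr s \<le> x powr s * (1 - s / x)"
      by (intro mult_left_mono) (auto simp: algebra_simps)
    also have "x powr s * (1 - 1 / x) powr s = (x - 1) powr s"
      using x by (subst powr_mult[symmetric]) (auto simp: algebra_simps)
    also have "x powr s * (1 - s / x) = x powr s - s * x powr (s - 1)"
      using x by (simp add: powr_diff algebra_simps)
    finally show ?thesis using False by simp
  qed
qed

lemma sum_powr_le:
  fixes s :: real
  assumes "0 < s"
  shows "(\<Sum>i = 1..R. real i powr (s - 1)) \<le> real R powr s / min 1 s"
proof (induction R)
  case (Suc R)
  have "min 1 s * real (Suc R) powr (s - 1) \<le> real (Suc R) powr s - real R powr s"
    using powr_increment_ge[of "real (Suc R)" s] assms by simp
  hence "real (Suc R) powr (s - 1) \<le> (real (Suc R) powr s - real R powr s) / min 1 s"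
    using assms by (simp add: pos_le_divide_eq mult.commute)
  thus ?case using Suc by (simp add: diff_divide_distrib)
qed (use assms in simp)

lemma power_diff_le:
  fixes a b :: real
  assumes "0 \<le> b" "b \<le> a" shows "a ^ d - b ^ d \<le> real d * (a - b) * a ^ (d - 1)"
proof -
  have "a ^ d - b ^ d = (a - b) * (\<Sum>i<d. b ^ (d - Suc i) * a ^ i)" by (rule power_diff_sumr2)
  also have "\<dots> \<le> (a - b) * (\<Sum>i<d. a ^ (d - 1))"
  proof (intro mult_left_mono sum_mono)
    fix i assume "i \<in> {..<d}"
    hence "a ^ (d - 1) = a ^ (d - Suc i) * a ^ i" by (simp add: power_add[symmetric])
    thus "b ^ (d - Suc i) * a ^ i \<le> a ^ (d - 1)"
      using assms by (auto intro!: mult_right_mono power_mono)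
  qed (use assms in auto)
  finally show ?thesis by (simp add: mult_ac)
qed

lemma sphere_size_le:
  assumes "1 \<le> i"
  shows "(2 * real i + 1) ^ d - (2 * real i - 1) ^ d \<le> 2 * real d * 3 ^ (d - 1) * real i ^ (d - 1)"
proof -
  have "(2 * real i + 1) ^ d - (2 * real i - 1) ^ d \<le> real d * 2 * (2 * real i + 1) ^ (d - 1)"
    using power_diff_le[of "2 * real i - 1" "2 * real i + 1" d] assms by simp
  also have "\<dots> \<le> real d * 2 * (3 * real i) ^ (d - 1)"
    using assms by (intro mult_left_mono power_mono) auto
  finally show ?thesis by (simp add: power_mult_distrib mult_ac)
qed

text \<open>Spheres of radius \<open>i\<close> have \<open>O(i ^ (d - 1))\<close> points, and \<open>\<Sum>i\<le>R. i powr (d - 1 - \<alpha>)\<close> is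
  of order \<open>R powr (d - \<alpha>)\<close> exactly because \<open>\<alpha> < d\<close>.\<close>
lemma ball_sum_le:
  assumes d: "1 \<le> d" and n: "3 \<le> n" and X: "X \<in> torus d n" and \<alpha>: "0 < \<alpha>" "\<alpha> < real d"
  shows "(\<Sum>Y\<in>torus d n. if 1 \<le> torus_dist d X Y \<and> torus_dist d X Y \<le> R
            then real (torus_dist d X Y) powr - \<alpha> else 0)
     \<le> 2 * real d * 3 ^ (d - 1) / min 1 (real d - \<alpha>) * real R powr (real d - \<alpha>)"
proof -
  define f where "f i = (if 1 \<le> i \<and> i \<le> R then real i powr - \<alpha> else 0)" for i
  let ?D = "torus_diam n"
  have D: "1 \<le> ?D" "n \<le> 2 * ?D + 1" using n by (auto simp: torus_diam_def)
  have f: "0 \<le> f i" for i by (simp add: f_def)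
  have "(\<Sum>Y\<in>torus d n. f (torus_dist d X Y)) =
    (\<Sum>i = 1..?D - 1. ((2 * real i + 1) ^ d - (2 * real i - 1) ^ d) * f i)
     + (real n ^ d - (2 * real ?D - 1) ^ d) * f ?D"
    using n by (intro sum_over_torus_spheres[OF d _ X]) (auto simp: f_def)
  also have "\<dots> \<le> (\<Sum>i = 1..?D - 1. ((2 * real i + 1) ^ d - (2 * real i - 1) ^ d) * f i)
     + ((2 * real ?D + 1) ^ d - (2 * real ?D - 1) ^ d) * f ?D"
    using D by (intro add_left_mono mult_right_mono diff_right_mono power_mono f) auto
  also have "\<dots> = (\<Sum>i = 1..?D. ((2 * real i + 1) ^ d - (2 * real i - 1) ^ d) * f i)"
  proof -
    have "{1..?D} = insert ?D {1..?D - 1}" using D by auto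
    moreover have "?D \<notin> {1..?D - 1}" using D by auto
    ultimately show ?thesis by simp
  qed
  also have "\<dots> \<le> (\<Sum>i = 1..?D. 2 * real d * 3 ^ (d - 1) * real i ^ (d - 1) * f i)"
    by (intro sum_mono mult_right_mono sphere_size_le f) auto
  also have "\<dots> = 2 * real d * 3 ^ (d - 1) * (\<Sum>i = 1..?D. real i ^ (d - 1) * f i)"
    by (simp add: sum_distrib_left mult_ac)
  also have "(\<Sum>i = 1..?D. real i ^ (d - 1) * f i) \<le> (\<Sum>i = 1..R. real i powr (real d - \<alpha> - 1))"
  proof -
    have "(\<Sum>i = 1..?D. real i ^ (d - 1) * f i) = (\<Sum>i\<in>{1..?D} \<inter> {1..R}. real i ^ (d - 1) * f i)"
      by (rule sum.mono_neutral_right) (auto simp: f_def)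
    also have "\<dots> \<le> (\<Sum>i = 1..R. real i ^ (d - 1) * f i)"
      by (rule sum_mono2) (auto simp: f)
    also have "\<dots> = (\<Sum>i = 1..R. real i powr (real d - \<alpha> - 1))"
      using d by (intro sum.cong) (auto simp: f_def powr_realpow[symmetric] powr_add[symmetric] of_nat_diff algebra_simps)
    finally show ?thesis .
  qed
  also have "\<dots> \<le> real R powr (real d - \<alpha>) / min 1 (real d - \<alpha>)"
    using \<alpha> by (intro sum_powr_le) auto
  finally show ?thesis unfolding f_def by (simp add: mult_left_mono)
qed

text \<open>Cut at distance \<open>\<beta> n\<close>. Nearer points contribute at most the full ball sum
  \<open>O((\<beta> n) powr (d - \<alpha>))\<close>, wherever \<open>U\<close> lies. Farther points contribute at most \<open>A2 (\<beta> n) powr (- \<alpha>)\<close> each,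
  and at most \<open>(\<beta> n) ^ d\<close> of them exist if \<open>\<delta> = \<beta> ^ d\<close>. Dividing by \<open>\<zeta>\<close> leaves a constant times
  \<open>\<beta> powr (d - \<alpha>)\<close>, uniformly in \<open>n\<close> and \<open>\<rho>\<close>.\<close>
lemma small_set_small_rate:
  fixes \<tau> :: real
  assumes d: "1 \<le> d" and \<alpha>: "0 < \<alpha>" "\<alpha> < real d" and A: "0 < A1" "A1 \<le> A2" and \<tau>: "0 < \<tau>"
  shows "\<exists>\<delta>>0. \<forall>\<rho> n X U. power_law_profile A1 A2 \<alpha> \<rho> \<longrightarrow> 3 \<le> n \<longrightarrow> X \<in> torus d n \<longrightarrow> U \<subseteq> torus d n
     \<longrightarrow> real (card U) \<le> \<delta> * real n ^ d
     \<longrightarrow> (\<Sum>Y\<in>U. inverse (zeta d \<rho> n) * \<rho> (real (torus_dist d X Y))) \<le> \<tau>"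
proof -
  define s where "s = real d - \<alpha>"
  define K where "K = 2 * real d * 3 ^ (d - 1) / min 1 s"
  define L where "L = 3 / A1 * (A2 * (K + 1))"
  \<comment> \<open>the solution of \<open>L * \<beta> powr s = \<tau>\<close>, the bound at which the estimate arrives\<close>
  define \<beta> where "\<beta> = (\<tau> / L) powr (1 / s)"
  have s: "0 < s" using \<alpha> by (simp add: s_def)
  have K: "0 \<le> K" using s by (simp add: K_def)
  have L: "0 < L" using K A unfolding L_def by (intro mult_pos_pos divide_pos_pos) auto
  have \<beta>: "0 < \<beta>" "\<beta> powr s = \<tau> / L" using \<tau> L s by (auto simp: \<beta>_def powr_powr)
  show ?thesis
  proof (intro exI[of _ "\<beta> ^ d"] conjI allI impI)
    fix \<rho> n X U
    assume \<rho>: "power_law_profile A1 A2 \<alpha> \<rho>" and n: "3 \<le> n" and X: "X \<in> torus d n"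
      and U: "U \<subseteq> torus d n" and cardU: "real (card U) \<le> \<beta> ^ d * real n ^ d"
    define R where "R = nat \<lfloor>\<beta> * real n\<rfloor>"
    define f where "f k = (if 1 \<le> k \<and> k \<le> R then real k powr - \<alpha> else 0)" for k
    have bn: "0 < \<beta> * real n" using \<beta> n by simp
    have R: "real R \<le> \<beta> * real n" "\<beta> * real n < real R + 1"
      using bn by (auto simp: R_def)
    have pw: "\<rho> (real k) \<le> A2 * f k + A2 * (\<beta> * real n) powr - \<alpha>" for k
    proof (cases "k = 0")
      case True
      thus ?thesis using \<rho> A by (auto simp: f_def power_law_profile_def)
    next
      case k: False
      show ?thesis
      proof (cases "k \<le> R")
        case True
        hence "\<rho> (real k) \<le> A2 * f k" using k \<rho> by (auto simp: f_def power_law_profile_def)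
        thus ?thesis using A by (simp add: add_increasing2)
      next
        case False
        hence "real R + 1 \<le> real k" by simp
        hence "\<rho> (real k) \<le> A2 * (\<beta> * real n) powr - \<alpha>"
          using R k A by (intro power_law_upper[OF \<rho> \<alpha>(1) _ bn]) auto
        thus ?thesis using False by (simp add: f_def)
      qed
    qed
    have fin: "finite (torus d n)" using finite_torus d n by simp
    have "(\<Sum>Y\<in>U. \<rho> (real (torus_dist d X Y)))
        \<le> (\<Sum>Y\<in>U. A2 * f (torus_dist d X Y) + A2 * (\<beta> * real n) powr - \<alpha>)"
      by (intro sum_mono pw)
    also have "\<dots> = A2 * (\<Sum>Y\<in>U. f (torus_dist d X Y)) + real (card U) * (A2 * (\<beta> * real n) powr - \<alpha>)"
      by (simp add: sum.distrib sum_distrib_left)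
    also have "\<dots> \<le> A2 * (K * (\<beta> * real n) powr s) + (\<beta> * real n) powr real d * (A2 * (\<beta> * real n) powr - \<alpha>)"
    proof (intro add_mono mult_left_mono mult_right_mono)
      have "(\<Sum>Y\<in>U. f (torus_dist d X Y)) \<le> (\<Sum>Y\<in>torus d n. f (torus_dist d X Y))"
        using U fin by (intro sum_mono2) (auto simp: f_def)
      also have "\<dots> \<le> K * real R powr s"
        using ball_sum_le[OF d n X \<alpha>, of R] unfolding f_def K_def s_def .
      also have "\<dots> \<le> K * (\<beta> * real n) powr s"
        using R s K by (intro mult_left_mono powr_mono2) auto
      finally show "(\<Sum>Y\<in>U. f (torus_dist d X Y)) \<le> K * (\<beta> * real n) powr s" .
      show "real (card U) \<le> (\<beta> * real n) powr real d"
        using cardU bn by (simp add: powr_realpow power_mult_distrib)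
    qed (use A in auto)
    also have "\<dots> = A2 * (K + 1) * (\<beta> * real n) powr s"
      by (simp add: s_def powr_diff powr_minus field_simps add_divide_distrib)
    also have "\<dots> = A2 * (K + 1) * (\<beta> powr s * real n powr s)"
      using \<beta> by (simp add: powr_mult)
    finally have sum_le: "(\<Sum>Y\<in>U. \<rho> (real (torus_dist d X Y))) \<le> A2 * (K + 1) * (\<beta> powr s * real n powr s)" .
    have "(\<Sum>Y\<in>U. inverse (zeta d \<rho> n) * \<rho> (real (torus_dist d X Y)))
        = inverse (zeta d \<rho> n) * (\<Sum>Y\<in>U. \<rho> (real (torus_dist d X Y)))"
      by (simp add: sum_distrib_left)
    also have "\<dots> \<le> (3 / A1 * real n powr (\<alpha> - real d)) * (A2 * (K + 1) * (\<beta> powr s * real n powr s))"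
      using inverse_zeta_le[OF d n \<rho> \<alpha>(1) A] sum_le A \<rho>
      by (intro mult_mono) (auto intro!: sum_nonneg simp: power_law_profile_def)
    also have "\<dots> = L * \<beta> powr s * (real n powr (\<alpha> - real d) * real n powr s)"
      by (simp add: L_def mult_ac)
    also have "real n powr (\<alpha> - real d) * real n powr s = 1"
      using n by (simp add: s_def powr_add[symmetric])
    finally show "(\<Sum>Y\<in>U. inverse (zeta d \<rho> n) * \<rho> (real (torus_dist d X Y))) \<le> \<tau>"
      using L \<beta> by simp
  qed (use \<beta> in simp)
qed

section \<open>Largest components\<close>

lemma largest_component_size_eq:
  assumes E: "E \<subseteq> vertex_pairs V"
  shows "largest_component_size V E = Max ((\<lambda>x. card (cluster E {x})) ` V)"
proof -
  have "connected_rel V E `` {x} = cluster E {x}" if "x \<in> V" for x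
    using that cluster_subset[OF E, of "{x}"] by (auto simp: connected_rel_def cluster_def)
  hence "components_of_graph V E = (\<lambda>x. cluster E {x}) ` V"
    by (auto simp: components_of_graph_def quotient_def)
  thus ?thesis by (simp add: largest_component_size_def image_image)
qed

lemma random_graph_eq_bond_graph: "random_graph V \<kappa> = bond_graph V (edge_prob \<kappa>)"
  by (simp add: random_graph_def bond_graph_def)

lemma edge_prob_doubleton:
  assumes "\<And>x y. \<kappa> x y = \<kappa> y x"
  shows "edge_prob \<kappa> {x, y} = 1 - exp (- \<kappa> x y)"
  unfolding edge_prob_def
  by (rule the_equality) (use assms in \<open>auto simp: doubleton_eq_iff\<close>)

lemma edge_prob_rate_kernel:
  "edge_prob (rate_kernel d \<rho> n t) {X, Y}
    = 1 - exp (- ((1 + t) * (inverse (zeta d \<rho> n) * \<rho> (real (torus_dist d X Y)))))"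
  by (subst edge_prob_doubleton) (simp_all add: rate_kernel_def torus_dist_commute mult.assoc)

lemma prob_largest_component_less:
  assumes fin: "finite V" and ne: "V \<noteq> {}"
    and b: "\<And>x. x \<in> V \<Longrightarrow> measure_pmf.prob (bond_graph V p) {E. k \<le> card (cluster E {x})} \<le> b"
  shows "1 - real (card V) * b \<le> measure_pmf.prob (bond_graph V p) {E. largest_component_size V E < k}"
proof -
  let ?P = "measure_pmf.prob (bond_graph V p)"
  have "1 - ?P {E. largest_component_size V E < k} = ?P {E. \<not> largest_component_size V E < k}"
    by (simp add: measure_pmf.prob_compl[symmetric] Compl_eq_Diff_UNIV[symmetric] Collect_neg_eq)
  also have "\<dots> \<le> ?P {E. \<exists>x\<in>V. k \<le> card (cluster E {x})}"
    by (rule prob_bond_graph_mono) (use fin ne in \<open>auto simp: largest_component_size_eq not_less Max_ge_iff\<close>)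
  also have "{E. \<exists>x\<in>V. k \<le> card (cluster E {x})} = (\<Union>x\<in>V. {E. k \<le> card (cluster E {x})})" by auto
  also have "?P \<dots> \<le> (\<Sum>x\<in>V. ?P {E. k \<le> card (cluster E {x})})"
    by (rule measure_UNION_le) (use fin in auto)
  also have "\<dots> \<le> real (card V) * b" by (intro sum_bounded_above b)
  finally show ?thesis by simp
qed

text \<open>Here the exploration starts without any active vertex and makes all of its \<open>k\<close> steps.\<close>
lemma prob_largest_component_ge:
  assumes fin: "finite V" "V \<noteq> {}" and k: "k \<le> card V" and M: "1 \<le> M"
    and p: "\<And>x y. x \<in> V \<Longrightarrow> y \<in> V \<Longrightarrow> x \<noteq> y \<Longrightarrow> 0 \<le> p {x, y} \<and> p {x, y} \<le> 1"
    and deg: "\<And>x U. x \<in> U \<Longrightarrow> U \<subseteq> V \<Longrightarrow> card U \<le> M + k \<Longrightarrow> l \<le> (\<Sum>y\<in>V - U. p {x, y})"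
    and m: "0 < m" "m \<le> 1" and r: "0 \<le> r" "exp ((m - 1) * l) \<le> m * r"
  shows "1 - r ^ k / m ^ M \<le> measure_pmf.prob (bond_graph V p) {E. M \<le> largest_component_size V E}"
proof -
  let ?P = "measure_pmf.prob (bond_graph V p)"
  have "1 - ?P {E. M \<le> largest_component_size V E} = ?P {E. \<not> M \<le> largest_component_size V E}"
    by (simp add: measure_pmf.prob_compl[symmetric] Compl_eq_Diff_UNIV[symmetric] Collect_neg_eq)
  also have "\<dots> \<le> ?P {E. card (cluster E {}) < M \<and> (\<forall>v\<in>V. card (cluster E {v}) < M)}"
    by (rule prob_bond_graph_mono)
       (use fin M in \<open>auto simp: largest_component_size_eq not_le cluster_def\<close>)
  also have "\<dots> \<le> r ^ k / m ^ M"
    using prob_no_large_cluster[where V = V and ?V0.0 = V and S = "{}" and j = k and k = k, OF fin(1) _ _ fin(1) p deg m r] k m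
    by (simp add: pos_le_divide_eq)
  finally show ?thesis by simp
qed

lemma filterlim_real_power_at_top:
  "1 \<le> d \<Longrightarrow> filterlim (\<lambda>n. real n ^ d) at_top sequentially"
  by (intro filterlim_pow_at_top filterlim_real_sequentially) auto

lemma eventually_rate_small:
  assumes "\<alpha> < real d" "0 < \<epsilon>"
  shows "\<forall>\<^sub>F n in sequentially. K * real n powr (\<alpha> - real d) < \<epsilon>"
proof -
  have "(\<lambda>n. real n powr (\<alpha> - real d)) \<longlonglongrightarrow> 0"
    by (rule tendsto_neg_powr) (use assms filterlim_real_sequentially in auto)
  hence "(\<lambda>n. K * real n powr (\<alpha> - real d)) \<longlonglongrightarrow> K * 0" by (intro tendsto_intros)
  thus ?thesis using assms by (intro order_tendstoD(2)[of _ "K * 0"]) auto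
qed

section \<open>The two regimes\<close>

text \<open>For \<open>m = 1 + \<epsilon> / 4\<close> and degrees at most \<open>1 - \<epsilon> / 2\<close> the exponent in \<open>exp ((m - 1) * l) \<le> m * a\<close> is
  \<open>\<epsilon> / 4 - 2 (\<epsilon> / 4)\<^sup>2\<close>, while \<open>ln m \<ge> \<epsilon> / 4 - (\<epsilon> / 4)\<^sup>2\<close>; the surplus gives \<open>a = exp (- \<epsilon>\<^sup>2 / 16)\<close>. Taking the
  threshold \<open>16 (d + 1) ln n / \<epsilon>\<^sup>2\<close> makes each vertex fail with probability \<open>O(n powr (- d - 1))\<close>.\<close>
lemma subcritical_at_n:
  assumes d: "1 \<le> d" and n: "3 \<le> n" and \<rho>: "power_law_profile A1 A2 \<alpha> \<rho>"
    and \<alpha>: "0 < \<alpha>" and A: "0 < A1" "A1 \<le> A2" and \<epsilon>: "0 < \<epsilon>" "\<epsilon> < 1"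
    and small: "3 * A2 / A1 * real n powr (\<alpha> - real d) \<le> \<epsilon>"
  shows "1 - 2 / real n \<le> measure_pmf.prob (random_graph (torus d n) (rate_kernel d \<rho> n (- \<epsilon>)))
      {E. real (largest_component_size (torus d n) E) \<le> 16 * (real d + 1) * inverse (\<epsilon>\<^sup>2) * ln (real n)}"
proof -
  let ?T = "torus d n" and ?p = "edge_prob (rate_kernel d \<rho> n (- \<epsilon>))"
  let ?w = "\<lambda>X Y. inverse (zeta d \<rho> n) * \<rho> (real (torus_dist d X Y))"
  have n1: "1 \<le> n" using n by simp
  note fin = finite_torus[OF d n1]
  have w0: "0 \<le> ?w X Y" for X Y
    using zeta_pos[OF d n \<rho> \<alpha> A] \<rho> by (auto simp: power_law_profile_def)
  have p: "?p {X, Y} = 1 - exp (- ((1 - \<epsilon>) * ?w X Y))" for X Y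
    by (simp add: edge_prob_rate_kernel)
  have p01: "0 \<le> ?p {X, Y} \<and> ?p {X, Y} \<le> 1" for X Y
    unfolding p using w0 \<epsilon> by (auto intro!: mult_nonneg_nonneg)
  have deg: "(\<Sum>Y\<in>?T - {X}. ?p {X, Y}) \<le> 1 - \<epsilon> / 2" if X: "X \<in> ?T" for X
  proof -
    have "(\<Sum>Y\<in>?T - {X}. ?p {X, Y}) \<le> (\<Sum>Y\<in>?T. ?p {X, Y})"
      by (rule sum_mono2[OF fin Diff_subset p01[THEN conjunct1]])
    also have "\<dots> \<le> (\<Sum>Y\<in>?T. (1 - \<epsilon> / 2) * (1 - exp (- ?w X Y)))"
      unfolding p using order_trans[OF rate_le[OF d n \<rho> \<alpha> A] small] w0 \<epsilon>
      by (intro sum_mono thinned_prob_le) auto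
    also have "\<dots> = 1 - \<epsilon> / 2"
      using expected_degree_eq_1[OF d n \<rho> \<alpha> A X] by (simp flip: sum_distrib_left)
    finally show ?thesis .
  qed
  define thr where "thr = 16 * (real d + 1) * inverse (\<epsilon>\<^sup>2) * ln (real n)"
  define k where "k = nat \<lceil>thr\<rceil>"
  define m where "m = 1 + \<epsilon> / 4"
  define a where "a = exp (- (\<epsilon>\<^sup>2 / 16))"
  have "exp ((m - 1) * (1 - \<epsilon> / 2)) = exp (\<epsilon> / 4 - (\<epsilon> / 4)\<^sup>2) * a"
    unfolding m_def a_def exp_add[symmetric] by (simp add: power2_eq_square algebra_simps)
  also have "\<dots> \<le> exp (ln (1 + \<epsilon> / 4)) * a"
    using ln_one_plus_pos_lower_bound[of "\<epsilon> / 4"] \<epsilon>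
    by (intro mult_right_mono) (auto simp: a_def simp del: exp_ln)
  finally have ma: "exp ((m - 1) * (1 - \<epsilon> / 2)) \<le> m * a" using \<epsilon> by (simp add: m_def)
  have "measure_pmf.prob (bond_graph ?T ?p) {E. k \<le> card (cluster E {X})} \<le> 2 * real n powr (- (real d + 1))"
    if X: "X \<in> ?T" for X
  proof -
    have "measure_pmf.prob (bond_graph ?T ?p) {E. k \<le> card (cluster E {X})} \<le> m ^ card {X} * a ^ k"
      by (rule prob_cluster_ge[where l = "1 - \<epsilon> / 2"]) (use fin X p01 deg ma \<epsilon> in \<open>auto simp: m_def a_def\<close>)
    also have "a ^ k \<le> exp (- (\<epsilon>\<^sup>2 / 16) * thr)"
    proof -
      have "a ^ k = exp (- (\<epsilon>\<^sup>2 / 16) * real k)" by (simp add: a_def exp_of_nat_mult[symmetric] mult.commute)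
      also have "thr \<le> real k" unfolding k_def by linarith
      hence "exp (- (\<epsilon>\<^sup>2 / 16) * real k) \<le> exp (- (\<epsilon>\<^sup>2 / 16) * thr)" by (simp add: mult_left_mono)
      finally show ?thesis .
    qed
    also have "exp (- (\<epsilon>\<^sup>2 / 16) * thr) = real n powr (- (real d + 1))"
      using \<epsilon> n by (simp add: thr_def powr_def field_simps)
    also have "m ^ card {X} * real n powr (- (real d + 1)) \<le> 2 * real n powr (- (real d + 1))"
      using \<epsilon> by (intro mult_right_mono) (auto simp: m_def)
    finally show ?thesis using \<epsilon> by (simp add: m_def mult_left_mono)
  qed
  hence "1 - real (card ?T) * (2 * real n powr (- (real d + 1)))
      \<le> measure_pmf.prob (bond_graph ?T ?p) {E. largest_component_size ?T E < k}"
    using fin torus_nonempty[OF d n1] by (intro prob_largest_component_less) auto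
  also have "\<dots> \<le> measure_pmf.prob (bond_graph ?T ?p) {E. real (largest_component_size ?T E) \<le> thr}"
  proof (rule prob_bond_graph_mono)
    fix E assume "largest_component_size ?T E < k"
    thus "real (largest_component_size ?T E) \<le> thr" unfolding k_def by linarith
  qed
  also have "real (card ?T) * (2 * real n powr (- (real d + 1))) = 2 / real n"
  proof -
    have "real n powr (- (real d + 1)) = inverse (real n ^ d * real n)"
      using n by (simp add: powr_minus powr_add powr_realpow del: minus_add_distrib)
    thus ?thesis using n by (simp add: card_torus[OF d n1] field_simps)
  qed
  finally show ?thesis by (simp add: random_graph_eq_bond_graph thr_def)
qed

text \<open>Small weights turn the factor \<open>1 + \<epsilon>\<close> in the kernel into a factor \<open>1 + \<epsilon> / 2\<close> in the degree. Half of this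
  surplus suffices to pay for the vertices of \<open>U\<close>.\<close>
lemma supercritical_degree:
  assumes d: "1 \<le> d" and n: "3 \<le> n" and \<rho>: "power_law_profile A1 A2 \<alpha> \<rho>"
    and \<alpha>: "0 < \<alpha>" and A: "0 < A1" "A1 \<le> A2" and \<epsilon>: "0 < \<epsilon>"
    and small: "3 * A2 / A1 * real n powr (\<alpha> - real d) \<le> \<epsilon> / (1 + \<epsilon>)\<^sup>2"
    and X: "X \<in> torus d n" and U: "U \<subseteq> torus d n"
    and depl: "(\<Sum>Y\<in>U. inverse (zeta d \<rho> n) * \<rho> (real (torus_dist d X Y))) \<le> \<epsilon> / (4 * (1 + \<epsilon>))"
  shows "1 + \<epsilon> / 4 \<le> (\<Sum>Y\<in>torus d n - U. edge_prob (rate_kernel d \<rho> n \<epsilon>) {X, Y})"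
proof -
  let ?T = "torus d n"
  let ?w = "\<lambda>Y. inverse (zeta d \<rho> n) * \<rho> (real (torus_dist d X Y))"
  have fin: "finite ?T" using finite_torus d n by simp
  have w0: "0 \<le> ?w Y" for Y
    using zeta_pos[OF d n \<rho> \<alpha> A] \<rho> by (auto simp: power_law_profile_def)
  have "1 + \<epsilon> / 4 \<le> (1 + \<epsilon> / 2) * (1 - \<epsilon> / (4 * (1 + \<epsilon>)))"
  proof -
    have "(1 + \<epsilon> / 2) * (\<epsilon> / (4 * (1 + \<epsilon>))) \<le> (1 + \<epsilon>) * (\<epsilon> / (4 * (1 + \<epsilon>)))"
      using \<epsilon> by (intro mult_right_mono) auto
    also have "\<dots> = \<epsilon> / 4" using \<epsilon> by (simp add: divide_simps)
    finally show ?thesis by (simp add: right_diff_distrib)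
  qed
  also have "\<dots> \<le> (1 + \<epsilon> / 2) * (1 - (\<Sum>Y\<in>U. 1 - exp (- ?w Y)))"
  proof -
    have "(\<Sum>Y\<in>U. 1 - exp (- ?w Y)) \<le> (\<Sum>Y\<in>U. ?w Y)"
    proof (rule sum_mono)
      fix Y show "1 - exp (- ?w Y) \<le> ?w Y" using exp_ge_add_one_self[of "- ?w Y"] by linarith
    qed
    thus ?thesis using depl \<epsilon> by (intro mult_left_mono) auto
  qed
  also have "1 - (\<Sum>Y\<in>U. 1 - exp (- ?w Y)) = (\<Sum>Y\<in>?T - U. 1 - exp (- ?w Y))"
    by (subst expected_degree_eq_1[OF d n \<rho> \<alpha> A X, symmetric], subst sum_diff[OF fin U]) simp
  also have "(1 + \<epsilon> / 2) * \<dots> \<le> (\<Sum>Y\<in>?T - U. 1 - exp (- ((1 + \<epsilon>) * ?w Y)))"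
    unfolding sum_distrib_left
    using order_trans[OF rate_le[OF d n \<rho> \<alpha> A] small] w0 \<epsilon>
    by (intro sum_mono boosted_prob_ge) auto
  finally show ?thesis by (simp only: edge_prob_rate_kernel)
qed

text \<open>To first order in \<open>h = 1 - m\<close>, the ratio \<open>r = exp (- h (1 + \<epsilon>)) / (1 - h)\<close> is \<open>1 - h \<epsilon>\<close>. The
  chosen \<open>h\<close> is half of the upper bound imposed by \<open>h / (1 - h) < h (1 + \<epsilon>)\<close>.\<close>
lemma supercritical_parameters:
  fixes \<epsilon> :: real
  assumes "0 < \<epsilon>"
  shows "\<exists>m r. 0 < m \<and> m < 1 \<and> 0 < r \<and> r < 1 \<and> exp ((m - 1) * (1 + \<epsilon>)) = m * r"
proof -
  define h where "h = \<epsilon> / (2 * (1 + \<epsilon>))"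
  have h: "0 < h" "h < 1" using assms by (auto simp: h_def field_simps)
  have "1 < (1 - h) * (1 + \<epsilon>)" using assms by (simp add: h_def field_simps add_pos_pos)
  hence "h / (1 - h) < h * (1 + \<epsilon>)" using h by (simp add: pos_divide_less_eq mult_ac)
  have "1 / (1 - h) = 1 + h / (1 - h)" using h by (simp add: field_simps)
  also have "\<dots> \<le> exp (h / (1 - h))" by simp
  also have "\<dots> < exp (h * (1 + \<epsilon>))" using \<open>h / (1 - h) < _\<close> by simp
  finally have "inverse (exp (h * (1 + \<epsilon>))) < inverse (1 / (1 - h))"
    using h by (intro less_imp_inverse_less) auto
  hence "exp (- (h * (1 + \<epsilon>))) < 1 - h" by (simp add: exp_minus)
  thus ?thesis using h
    by (intro exI[of _ "1 - h"] exI[of _ "exp (- (h * (1 + \<epsilon>))) / (1 - h)"]) auto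
qed

text \<open>Let \<open>N = n ^ d\<close>, and let \<open>k\<close> and \<open>M\<close> be \<open>\<delta> N / 2\<close> and \<open>C N\<close> up to rounding. The last hypothesis says
  that \<open>m ^ M\<close> consumes at most half of the exponential decay of \<open>r ^ k\<close>, where rounding costs the factor
  \<open>1 / (m * r)\<close>. As \<open>4 \<le> \<delta> N\<close>, the unit gained by \<open>M\<close> in rounding up still fits into
  \<open>M + k \<le> \<delta> N\<close>.\<close>
lemma supercritical_at_n:
  fixes n :: nat
  assumes d: "1 \<le> d" and n: "3 \<le> n" and \<rho>: "power_law_profile A1 A2 \<alpha> \<rho>"
    and \<alpha>: "0 < \<alpha>" and A: "0 < A1" "A1 \<le> A2" and \<epsilon>: "0 < \<epsilon>"
    and small: "3 * A2 / A1 * real n powr (\<alpha> - real d) \<le> \<epsilon> / (1 + \<epsilon>)\<^sup>2"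
    and depl: "\<And>X U. X \<in> torus d n \<Longrightarrow> U \<subseteq> torus d n \<Longrightarrow> real (card U) \<le> \<delta> * real n ^ d
      \<Longrightarrow> (\<Sum>Y\<in>U. inverse (zeta d \<rho> n) * \<rho> (real (torus_dist d X Y))) \<le> \<epsilon> / (4 * (1 + \<epsilon>))"
    and \<delta>: "0 < \<delta>" "\<delta> \<le> 1" "4 \<le> \<delta> * real n ^ d"
    and m: "0 < m" "m < 1" and r: "0 < r" "r < 1" "exp ((m - 1) * (1 + \<epsilon> / 4)) = m * r"
    and C: "0 < C" "C \<le> \<delta> / 4" "- C * ln m \<le> - (\<delta> / 4) * ln r"
  shows "1 - exp (\<delta> / 4 * ln r * real n ^ d) / (m * r)
    \<le> measure_pmf.prob (random_graph (torus d n) (rate_kernel d \<rho> n \<epsilon>))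
      {E. C * real n ^ d \<le> real (largest_component_size (torus d n) E)}"
proof -
  let ?T = "torus d n" and ?p = "edge_prob (rate_kernel d \<rho> n \<epsilon>)" and ?N = "real n ^ d"
  have n1: "1 \<le> n" using n by simp
  note fin = finite_torus[OF d n1]
  have N: "3 \<le> ?N" by (rule card_torus_ge[OF d n])
  define k where "k = nat \<lfloor>\<delta> * ?N / 2\<rfloor>"
  define M where "M = nat \<lceil>C * ?N\<rceil>"
  have CN: "0 < C * ?N" "C * ?N \<le> \<delta> * ?N / 4"
    using mult_pos_pos[OF C(1), of ?N] N mult_right_mono[OF C(2), of ?N] by linarith+
  have dN: "0 \<le> \<delta> * ?N" "\<delta> * ?N \<le> ?N" using \<delta> N mult_right_mono[OF \<delta>(2), of ?N] by auto
  have k: "real k \<le> \<delta> * ?N / 2" "\<delta> * ?N / 2 - 1 \<le> real k"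
    using dN unfolding k_def by linarith+
  have M: "C * ?N \<le> real M" "real M \<le> C * ?N + 1" "1 \<le> M"
    using CN unfolding M_def by linarith+
  have Mk: "real (M + k) \<le> \<delta> * ?N" using k M CN \<delta>(3) by simp
  have "1 - r ^ k / m ^ M \<le> measure_pmf.prob (bond_graph ?T ?p) {E. M \<le> largest_component_size ?T E}"
  proof (rule prob_largest_component_ge[where l = "1 + \<epsilon> / 4"])
    show "?T \<noteq> {}" using torus_nonempty[OF d n1] by auto
    have "real (card ?T) = ?N" by (simp add: card_torus[OF d n1])
    hence "real k \<le> real (card ?T)" using k dN by linarith
    thus "k \<le> card ?T" by linarith
    show "0 \<le> ?p {X, Y} \<and> ?p {X, Y} \<le> 1" for X Y
      unfolding edge_prob_rate_kernel using zeta_pos[OF d n \<rho> \<alpha> A] \<rho> \<epsilon>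
      by (auto simp: power_law_profile_def intro!: mult_nonneg_nonneg)
    fix X U assume X: "X \<in> U" and U: "U \<subseteq> ?T" and cU: "card U \<le> M + k"
    have "real (card U) \<le> \<delta> * ?N" using cU Mk by linarith
    thus "1 + \<epsilon> / 4 \<le> (\<Sum>Y\<in>?T - U. ?p {X, Y})"
      using X U by (intro supercritical_degree[OF d n \<rho> \<alpha> A \<epsilon> small _ U] depl) auto
  qed (use fin M m r in auto)
  also have "\<dots> \<le> measure_pmf.prob (bond_graph ?T ?p) {E. C * ?N \<le> real (largest_component_size ?T E)}"
  proof (rule prob_bond_graph_mono)
    fix E assume "M \<le> largest_component_size ?T E"
    thus "C * ?N \<le> real (largest_component_size ?T E)" using M(1) by linarith
  qed
  finally have main: "1 - r ^ k / m ^ M \<le> \<dots>" .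
  have lnr: "ln r < 0" and lnm: "ln m < 0" using m r by auto
  have "r ^ k / m ^ M = exp (real k * ln r - real M * ln m)"
    using m r by (simp add: exp_diff exp_of_nat_mult)
  also have "\<dots> \<le> exp (\<delta> / 4 * ln r * ?N - ln r - ln m)"
  proof -
    have "real k * ln r \<le> (\<delta> * ?N / 2 - 1) * ln r" using k lnr by (intro mult_right_mono_neg) auto
    moreover have "(C * ?N + 1) * ln m \<le> real M * ln m" using M lnm by (intro mult_right_mono_neg) auto
    moreover have "(- C * ln m) * ?N \<le> (- (\<delta> / 4) * ln r) * ?N" using C N by (intro mult_right_mono) auto
    ultimately show ?thesis by (simp add: algebra_simps)
  qed
  also have "\<dots> = exp (\<delta> / 4 * ln r * ?N) / (m * r)"
    using m r by (simp add: exp_diff)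
  finally show ?thesis using main by (simp add: random_graph_eq_bond_graph)
qed

lemma tendsto_prob_1:
  assumes "\<forall>\<^sub>F n in sequentially. 1 - b n \<le> measure_pmf.prob (G n) (A n)" "b \<longlonglongrightarrow> (0::real)"
  shows "(\<lambda>n. measure_pmf.prob (G n) (A n)) \<longlonglongrightarrow> 1"
proof (rule tendsto_sandwich[OF assms(1)])
  show "(\<lambda>n. 1 - b n) \<longlonglongrightarrow> 1" using tendsto_diff[OF tendsto_const[of 1] assms(2)] by simp
qed auto

lemma subcritical:
  assumes d: "1 \<le> d" and \<alpha>: "0 < \<alpha>" "\<alpha> < real d" and A: "0 < A1" "A1 \<le> A2"
    and \<rho>: "power_law_profile A1 A2 \<alpha> \<rho>" and \<epsilon>: "0 < \<epsilon>" "\<epsilon> < 1"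
  shows "(\<lambda>n. measure_pmf.prob (random_graph (torus d n) (rate_kernel d \<rho> n (- \<epsilon>)))
      {E. real (largest_component_size (torus d n) E) \<le> 16 * (real d + 1) * inverse (\<epsilon>\<^sup>2) * ln (real n)})
    \<longlonglongrightarrow> 1"
proof (rule tendsto_prob_1)
  show "\<forall>\<^sub>F n in sequentially. 1 - 2 / real n \<le>
      measure_pmf.prob (random_graph (torus d n) (rate_kernel d \<rho> n (- \<epsilon>)))
      {E. real (largest_component_size (torus d n) E) \<le> 16 * (real d + 1) * inverse (\<epsilon>\<^sup>2) * ln (real n)}"
    using eventually_ge_at_top[of 3] eventually_rate_small[OF \<alpha>(2) \<epsilon>(1), of "3 * A2 / A1"]
    by eventually_elim (intro subcritical_at_n[OF d _ \<rho> \<alpha>(1) A \<epsilon>], auto)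
qed (rule lim_const_over_n)

lemma supercritical:
  assumes d: "1 \<le> d" and \<alpha>: "0 < \<alpha>" "\<alpha> < real d" and A: "0 < A1" "A1 \<le> A2" and \<epsilon>: "0 < \<epsilon>"
  shows "\<exists>C>0. \<forall>\<rho>. power_law_profile A1 A2 \<alpha> \<rho> \<longrightarrow>
    (\<lambda>n. measure_pmf.prob (random_graph (torus d n) (rate_kernel d \<rho> n \<epsilon>))
      {E. C * real n ^ d \<le> real (largest_component_size (torus d n) E)}) \<longlonglongrightarrow> 1"
proof -
  have "0 < \<epsilon> / (4 * (1 + \<epsilon>))" using \<epsilon> by simp
  from small_set_small_rate[OF d \<alpha> A this] obtain \<delta>' where \<delta>': "0 < \<delta>'"
    and depl: "\<And>\<rho> n X U. power_law_profile A1 A2 \<alpha> \<rho> \<Longrightarrow> 3 \<le> n \<Longrightarrow> X \<in> torus d n \<Longrightarrow> U \<subseteq> torus d n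
     \<Longrightarrow> real (card U) \<le> \<delta>' * real n ^ d
     \<Longrightarrow> (\<Sum>Y\<in>U. inverse (zeta d \<rho> n) * \<rho> (real (torus_dist d X Y))) \<le> \<epsilon> / (4 * (1 + \<epsilon>))"
    by blast
  \<comment> \<open>at most 1, so that there are enough vertices for \<open>\<delta> n ^ d / 2\<close> steps\<close>
  define \<delta> where "\<delta> = min \<delta>' 1"
  have \<delta>: "0 < \<delta>" "\<delta> \<le> 1" "\<delta> \<le> \<delta>'" using \<delta>' by (auto simp: \<delta>_def)
  obtain m r where m: "0 < m" "m < 1" and r: "0 < r" "r < 1" "exp ((m - 1) * (1 + \<epsilon> / 4)) = m * r"
    using supercritical_parameters[of "\<epsilon> / 4"] \<epsilon> by auto
  \<comment> \<open>the second bound makes \<open>m powr (- C)\<close> at most \<open>r powr (- \<delta> / 4)\<close>\<close>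
  define C where "C = min (\<delta> / 4) (\<delta> / 4 * ln r / ln m)"
  have ln: "ln r < 0" "ln m < 0" using m r by auto
  have C: "0 < C" "C \<le> \<delta> / 4" using \<delta> ln by (auto simp: C_def intro!: divide_neg_neg mult_pos_neg)
  have C': "- C * ln m \<le> - (\<delta> / 4) * ln r"
  proof -
    have "C * (- ln m) \<le> (\<delta> / 4 * ln r / ln m) * (- ln m)"
      using ln by (intro mult_right_mono) (auto simp: C_def)
    thus ?thesis using ln by simp
  qed
  show ?thesis
  proof (intro exI[of _ C] conjI C(1) allI impI)
    fix \<rho> assume \<rho>: "power_law_profile A1 A2 \<alpha> \<rho>"
    have N: "filterlim (\<lambda>n. real n ^ d) at_top sequentially" by (rule filterlim_real_power_at_top[OF d])
    have "\<forall>\<^sub>F n in sequentially. 4 / \<delta> \<le> real n ^ d" using N by (simp add: filterlim_at_top)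
    hence large: "\<forall>\<^sub>F n in sequentially. 4 \<le> \<delta> * real n ^ d"
      by eventually_elim (use \<delta> in \<open>simp add: field_simps\<close>)
    have "0 < \<epsilon> / (1 + \<epsilon>)\<^sup>2" using \<epsilon> by simp
    note rate = eventually_rate_small[OF \<alpha>(2) this, of "3 * A2 / A1"]
    show "(\<lambda>n. measure_pmf.prob (random_graph (torus d n) (rate_kernel d \<rho> n \<epsilon>))
      {E. C * real n ^ d \<le> real (largest_component_size (torus d n) E)}) \<longlonglongrightarrow> 1"
    proof (rule tendsto_prob_1)
      show "\<forall>\<^sub>F n in sequentially. 1 - exp (\<delta> / 4 * ln r * real n ^ d) / (m * r)
        \<le> measure_pmf.prob (random_graph (torus d n) (rate_kernel d \<rho> n \<epsilon>))
          {E. C * real n ^ d \<le> real (largest_component_size (torus d n) E)}"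
        using eventually_ge_at_top[of 3] rate large
      proof eventually_elim
        case (elim n)
        have "\<delta> * real n ^ d \<le> \<delta>' * real n ^ d" using \<delta> by (intro mult_right_mono) auto
        hence "(\<Sum>Y\<in>U. inverse (zeta d \<rho> n) * \<rho> (real (torus_dist d X Y))) \<le> \<epsilon> / (4 * (1 + \<epsilon>))"
          if "X \<in> torus d n" "U \<subseteq> torus d n" "real (card U) \<le> \<delta> * real n ^ d" for X U
          using depl[OF \<rho> elim(1) that(1,2)] that(3) by linarith
        thus ?case
          using elim \<delta> by (intro supercritical_at_n[OF d _ \<rho> \<alpha>(1) A \<epsilon> _ _ _ _ _ m r C C']) auto
      qed
      have "filterlim (\<lambda>n. \<delta> / 4 * ln r * real n ^ d) at_bot sequentially"
        using \<delta> ln by (intro filterlim_tendsto_neg_mult_at_bot[OF tendsto_const _ N] mult_pos_neg) auto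
      hence "(\<lambda>n. exp (\<delta> / 4 * ln r * real n ^ d)) \<longlonglongrightarrow> 0"
        by (rule filterlim_compose[OF exp_at_bot])
      thus "(\<lambda>n. exp (\<delta> / 4 * ln r * real n ^ d) / (m * r)) \<longlonglongrightarrow> 0"
        by (rule tendsto_divide_zero)
    qed
  qed
qed

theorem proposition2p8:
  fixes d :: nat
  assumes "d \<ge> 1"
  shows "(\<exists>C::real. C > 0 \<and>
            (\<forall>(\<alpha>::real) (A1::real) (A2::real) (\<rho>::real \<Rightarrow> real) (\<epsilon>::real).
               0 < \<alpha> \<and> \<alpha> < real d \<and> 0 < A1 \<and> A1 \<le> A2 \<and> power_law_profile A1 A2 \<alpha> \<rho> \<and>
               0 < \<epsilon> \<and> \<epsilon> < 1 \<longrightarrow>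
               (\<lambda>n. measure_pmf.prob (random_graph (torus d n) (rate_kernel d \<rho> n (- \<epsilon>)))
                      {E. real (largest_component_size (torus d n) E)
                            \<le> C * inverse (\<epsilon>\<^sup>2) * ln (real n)}) \<longlonglongrightarrow> 1)) \<and>
         (\<forall>(\<epsilon>::real) (\<alpha>::real) (A1::real) (A2::real).
            0 < \<epsilon> \<and> 0 < \<alpha> \<and> \<alpha> < real d \<and> 0 < A1 \<and> A1 \<le> A2 \<longrightarrow>
            (\<exists>C::real. C > 0 \<and>
               (\<forall>\<rho>::real \<Rightarrow> real. power_law_profile A1 A2 \<alpha> \<rho> \<longrightarrow>
                  (\<lambda>n. measure_pmf.prob (random_graph (torus d n) (rate_kernel d \<rho> n \<epsilon>))
                         {E. real (largest_component_size (torus d n) E)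
                               \<ge> C * real n ^ d}) \<longlonglongrightarrow> 1)))"
proof (rule conjI[OF exI[of _ "16 * (real d + 1)"]])
qed (use subcritical[OF assms] supercritical[OF assms] in auto)

end
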